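(* Let $q$ be a prime power and $n=2$. The following two assertions are equivalent. (1) For every composition $\alpha$ of $2$ and every integer $m\ge0$, $$\mathrm{Hilb}\bigl((S/\mathfrak{m}^{[q^m]})^{P_\alpha},t\bigr)=C_{\alpha,m}(t).$$ (2) For every composition $\alpha=(\alpha_1,\dots,\alpha_\ell)$ of $2$, $$\mathrm{Hilb}(S_{P_\alpha},t)=\sum_{\beta:\ \beta\le\alpha} t^{\sum_{i=1}^\ell\alpha_i(q^{B_i}-1)}\prod_{i=1}^\ell\prod_{j=0}^{\beta_i-1}\frac{1}{1-t^{q^{B_i}-q^{B_{i-1}+j}}}.$$
   Context: $S=\mathbb{F}_q[x_1,x_2]$ with the standard grading; $g=(g_{ij})\in GL_2(\mathbb{F}_q)$ acts on $S$ by $\mathbb{F}_q$-algebra automorphisms with $g(x_j)=\sum_i g_{ij}x_i$. $\mathfrak{m}^{[q^m]}=(x_1^{q^m},x_2^{q^m})$, a $GL_2(\mathbb{F}_q)$-stable ideal. A composition of $2$ is $\alpha=(2)$ or $\alpha=(1,1)$; $P_\alpha\subset GL_2(\mathbb{F}_q)$ is the subgroup of block upper-triangular invertible matrices with diagonal block sizes given by $\alpha$. A superscript $P_\alpha$ denotes the fixed subspace. The cofixed space $S_{P_\alpha}$ is $S/N$, where $N$ is the $\mathbb{F}_q$-span of all $g(f)-f$, $g\in P_\alpha$, $f\in S$. For a graded vector space $U$, $\mathrm{Hilb}(U,t)=\sum_d\dim_{\mathbb{F}_q}(U_d)t^d$. Sums over $\beta$ run over weak compositions $\beta=(\beta_1,\dots,\beta_\ell)$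 (nonnegative integers) with $\beta_i\le\alpha_i$ for all $i$; $|\beta|=\sum\beta_i$, $B_i=\beta_1+\cdots+\beta_i$, $B_0=0$. Empty products are $1$. Finally $$C_{\alpha,m}(t)=\sum_{\substack{\beta\le\alpha\\|\beta|\le m}}t^{\sum_{i=1}^\ell(\alpha_i-\beta_i)(q^m-q^{B_i})}\ \frac{\prod_{j=0}^{|\beta|-1}(1-t^{q^m-q^j})}{\prod_{i=1}^{\ell}\prod_{j=0}^{\beta_i-1}\bigl(1-t^{q^{B_i}-q^{B_{i-1}+j}}\bigr)}.$$ *)

theory Defs
  imports
    "HOL-Analysis.Analysis"
    "HOL-Library.Poly_Mapping"
    "HOL-Library.Set_Algebras"
    "HOL-Computational_Algebra.Formal_Power_Series"
    "Jordan_Normal_Form.VS_Connect"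
begin

no_notation Matrix.vec_index (infixl \<open>$\<close> 100)

section \<open>The polynomial ring in two variables\<close>

text \<open>
  Exponent vectors are finitely supported functions from the two-element type \<open>2\<close>, whose elements
  are \<open>1\<close> and \<open>2\<close>, to \<open>nat\<close>. The ground field is a finite type \<open>'k\<close> of class \<open>field\<close>, so that
  \<open>q = CARD('k)\<close>.
\<close>

type_synonym 'k poly2 = "(2 \<Rightarrow>\<^sub>0 nat) \<Rightarrow>\<^sub>0 'k"

definition Var :: "2 \<Rightarrow> 'k::field poly2"
  where "Var i = Poly_Mapping.single (Poly_Mapping.single i 1) 1"

definition poly_scale :: "'k::field \<Rightarrow> 'k poly2 \<Rightarrow> 'k poly2"
  where "poly_scale c f = Poly_Mapping.single 0 c * f"

interpretation poly2: Vector_Spaces.vector_space "poly_scale :: 'k::field \<Rightarrow> 'k poly2 \<Rightarrow> 'k poly2"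
proof
  fix a b :: 'k and f g :: "'k poly2"
  show "poly_scale a (f + g) = poly_scale a f + poly_scale a g"
    by (simp add: poly_scale_def algebra_simps)
  show "poly_scale (a + b) f = poly_scale a f + poly_scale b f"
    by (simp add: poly_scale_def algebra_simps single_add)
  show "poly_scale a (poly_scale b f) = poly_scale (a * b) f"
    by (simp add: poly_scale_def mult.assoc [symmetric] mult_single)
  show "poly_scale 1 f = f"
    by (simp add: poly_scale_def)
qed

definition homogeneous :: "nat \<Rightarrow> 'k::field poly2 set"
  where "homogeneous d =
    {f. \<forall>e \<in> Poly_Mapping.keys f. (\<Sum>i\<in>UNIV. Poly_Mapping.lookup e i) = d}"

text \<open>The algebra endomorphism with \<open>x\<^sub>j \<mapsto> \<Sum>\<^sub>i g\<^sub>i\<^sub>j x\<^sub>i\<close>, written out on monomials.\<close>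

definition act :: "'k::field^2^2 \<Rightarrow> 'k poly2 \<Rightarrow> 'k poly2"
  where "act g f =
    (\<Sum>e\<in>Poly_Mapping.keys f. poly_scale (Poly_Mapping.lookup f e)
       (\<Prod>j\<in>UNIV. (\<Sum>i\<in>UNIV. poly_scale (g $ i $ j) (Var i)) ^ Poly_Mapping.lookup e j))"

text \<open>The ideal generated by \<open>x\<^sub>1\<^sup>Q\<close> and \<open>x\<^sub>2\<^sup>Q\<close>.\<close>

definition frobenius_power :: "nat \<Rightarrow> 'k::field poly2 set"
  where "frobenius_power Q = {\<Sum>i\<in>UNIV. a i * Var i ^ Q | a. True}"


section \<open>Compositions and parabolic subgroups\<close>

definition compositions :: "nat \<Rightarrow> nat list set"
  where "compositions n = {\<alpha>. (\<forall>a\<in>set \<alpha>. 0 < a) \<and> sum_list \<alpha> = n}"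

text \<open>
  \<open>position\<close> is needed because \<open>2 = 0\<close> in the type \<open>2\<close>, and hence \<open>2 < 1\<close> in the library's order.
  Positions, parts of compositions and blocks are all counted from \<open>0\<close>.
\<close>

definition position :: "2 \<Rightarrow> nat"
  where "position i = (if i = 1 then 0 else 1)"

definition block :: "nat list \<Rightarrow> 2 \<Rightarrow> nat"
  where "block \<alpha> i = (LEAST k. position i < sum_list (take (Suc k) \<alpha>))"

definition parabolic :: "nat list \<Rightarrow> ('k::field^2^2) set"
  where "parabolic \<alpha> = {g. invertible g \<and> (\<forall>i j. block \<alpha> j < block \<alpha> i \<longrightarrow> g $ i $ j = 0)}"


section \<open>Quotient spaces and Hilbert series\<close>

text \<open>
  The vector space structure on a set \<open>C\<close> of cosets of a subspace \<open>N\<close>. Addition is elementwise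
  addition of sets; the summand \<open>N\<close> in the scalar multiplication only matters for the scalar \<open>0\<close>.
  The fields \<open>mult\<close> and \<open>one\<close> of the record play no role for modules.
\<close>

definition coset_space :: "'k::field poly2 set \<Rightarrow> 'k poly2 set set \<Rightarrow> ('k, 'k poly2 set) module"
  where "coset_space N C =
    \<lparr>carrier = C, mult = undefined, one = undefined, zero = N, add = (+),
     smult = (\<lambda>c A. poly_scale c ` A + N)\<rparr>"

text \<open>
  The degree \<open>d\<close> part of \<open>S/N\<close> for a homogeneous subspace \<open>N\<close>, i.e. the image of the degree \<open>d\<close>
  part of \<open>S\<close>.
\<close>

definition quotient_degree :: "'k::field poly2 set \<Rightarrow> nat \<Rightarrow> 'k poly2 set set"
  where "quotient_degree N d = (\<lambda>f. f +o N) ` homogeneous d"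

text \<open>An element \<open>g\<close> acts on \<open>S/I\<close>, for a stable ideal \<open>I\<close>, by \<open>A \<mapsto> g(A)\<close> on cosets \<open>A\<close>.\<close>

definition fixed_quotient ::
    "('k::field^2^2) set \<Rightarrow> 'k poly2 set \<Rightarrow> nat \<Rightarrow> ('k, 'k poly2 set) module"
  where "fixed_quotient G I d =
    coset_space I {A \<in> quotient_degree I d. \<forall>g\<in>G. act g ` A = A}"

definition cofixed :: "('k::field^2^2) set \<Rightarrow> nat \<Rightarrow> ('k, 'k poly2 set) module"
  where "cofixed G d =
    (let N = poly2.span {act g f - f | g f. g \<in> G} in coset_space N (quotient_degree N d))"

text \<open>A graded vector space is given by the family \<open>U\<close> of its homogeneous components.\<close>

definition Hilb :: "(nat \<Rightarrow> ('k::field, 'v) module) \<Rightarrow> rat fps"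
  where "Hilb U = Abs_fps (\<lambda>d. of_nat (vectorspace.dim class_ring (U d)))"


section \<open>The two families of series\<close>

definition weak_subcompositions :: "nat list \<Rightarrow> nat list set"
  where "weak_subcompositions \<alpha> =
    {\<beta>. length \<beta> = length \<alpha> \<and> (\<forall>i<length \<alpha>. \<beta> ! i \<le> \<alpha> ! i)}"

definition partial_sum :: "nat list \<Rightarrow> nat \<Rightarrow> nat"
  where "partial_sum \<beta> i = sum_list (take i \<beta>)"

text \<open>
  Since lists are indexed from \<open>0\<close>, the index \<open>i\<close> below is one less than the customary one: \<open>\<beta>\<^sub>i\<close> and
  \<open>B\<^sub>i\<close>, \<open>B\<^sub>i\<^sub>-\<^sub>1\<close> appear as \<open>\<beta> ! i\<close> and \<open>partial_sum \<beta> (Suc i)\<close>, \<open>partial_sum \<beta> i\<close>. None of the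
  subtractions truncates, and all denominators have constant coefficient \<open>1\<close>.
\<close>

definition C_series :: "nat \<Rightarrow> nat list \<Rightarrow> nat \<Rightarrow> rat fps"
  where "C_series q \<alpha> m =
    (\<Sum>\<beta> | \<beta> \<in> weak_subcompositions \<alpha> \<and> sum_list \<beta> \<le> m.
       fps_X ^ (\<Sum>i<length \<alpha>. (\<alpha> ! i - \<beta> ! i) * (q ^ m - q ^ partial_sum \<beta> (Suc i))) *
       ((\<Prod>j<sum_list \<beta>. 1 - fps_X ^ (q ^ m - q ^ j)) /
        (\<Prod>i<length \<alpha>. \<Prod>j<\<beta> ! i.
           1 - fps_X ^ (q ^ partial_sum \<beta> (Suc i) - q ^ (partial_sum \<beta> i + j)))))"

definition cofixed_series :: "nat \<Rightarrow> nat list \<Rightarrow> rat fps"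
  where "cofixed_series q \<alpha> =
    (\<Sum>\<beta>\<in>weak_subcompositions \<alpha>.
       fps_X ^ (\<Sum>i<length \<alpha>. \<alpha> ! i * (q ^ partial_sum \<beta> (Suc i) - 1)) *
       (\<Prod>i<length \<alpha>. \<Prod>j<\<beta> ! i.
          1 / (1 - fps_X ^ (q ^ partial_sum \<beta> (Suc i) - q ^ (partial_sum \<beta> i + j)))))"

end

theory Submission
  imports Defs
begin

text \<open>
  Put \<open>Q = q\<^sup>m\<close> and \<open>D = 2 (Q - 1)\<close>. The coefficient of \<open>(x\<^sub>1 x\<^sub>2)\<^sup>Q\<^sup>-\<^sup>1\<close> is a \<open>GL\<^sub>2\<close>-invariant functional,
  and it makes multiplication a perfect pairing between \<open>S/I\<close> in degree \<open>D - e\<close> and \<open>S\<close> in degree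
  \<open>e\<close> if \<open>e < Q\<close>, where \<open>I = (x\<^sub>1\<^sup>Q, x\<^sub>2\<^sup>Q)\<close>. Hence the fixed space of \<open>S/I\<close> in degree \<open>D - e\<close> is dual
  to the cofixed space of \<open>S\<close> in degree \<open>e\<close>. In degrees below \<open>Q\<close> the ideal vanishes, and the fixed
  space consists of honest invariants, whose number is governed by Dickson's theorem. For two
  variables the degrees below \<open>Q\<close> and the degrees \<open>D - e\<close> with \<open>e < Q\<close> exhaust \<open>0, \<dots>, D\<close>. The
  coefficients of \<open>C\<^sub>\<alpha>\<^sub>,\<^sub>m\<close> have the same behaviour: below \<open>Q\<close> they are those of the Hilbert series of
  the invariant ring, and read backwards from \<open>D\<close> they are those of the cofixed series, because each
  summand is a power of \<open>t\<close> times a palindromic polynomial. All dimensions are compared by counting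
  elements of vector spaces over the finite field.
\<close>

subsection \<open>Counting elements of coset spaces\<close>

text \<open>The two ranges of degrees meet, in the single degree Q - 1, because the socle degree is
  only twice Q - 1. Neither assertion is proved outright: passing from fixed to cofixed spaces uses
  duality alone, with m large for the given degree, and the converse adds unconditional knowledge of
  the remaining degrees. The low coefficients of C are the one coincidence that does not hold
  summand by summand: from degree Q - q on, the numerator of the summand with |beta| = 2 subtracts
  terms which the summands with |beta| = 1 put back. Dickson's theorem enters only as a count.
  Restriction to the line x_1 = 0 gives a recursion in the degree, witnessed by two invariants u and
  w of degrees a and b, and the coefficients of 1/((1 - t^a)(1 - t^b)) obey the same recursion.
  Palindromicity needs the quotients in C to be polynomials, which for \<open>GL2\<close> and odd m
  is not visible factor by factor. Products of cardinalities take the place of exact sequences, and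
  a dimension is read off as an exponent of q.\<close>

lemma card_eq_card_image_mult_fibre:
  assumes "finite F" "\<And>x. x \<in> F \<Longrightarrow> card {y \<in> F. \<psi> y = \<psi> x} = n"
  shows "card F = card (\<psi> ` F) * n"
proof -
  have "card F = (\<Sum>t\<in>\<psi> ` F. card {y \<in> F. \<psi> y = t})"
    using sum.image_gen [OF assms(1), of "\<lambda>_. 1::nat" \<psi>] by simp
  also have "\<dots> = (\<Sum>t\<in>\<psi> ` F. n)"
    using assms(2) by (intro sum.cong) auto
  finally show ?thesis by simp
qed

text \<open>The fibre through x is the translate x + K. Since only differences are compared, the
  values of \<open>\<psi>\<close> need no group structure: cosets, scalars and restricted functions
  all occur as values later.\<close>

lemma card_eq_card_image_mult_kernel:
  fixes F :: "'a::ab_group_add set"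
  assumes "finite F" "K \<subseteq> F" "\<And>x y. x \<in> F \<Longrightarrow> y \<in> K \<Longrightarrow> x + y \<in> F"
    and "\<And>x y. x \<in> F \<Longrightarrow> y \<in> F \<Longrightarrow> \<psi> y = \<psi> x \<longleftrightarrow> y - x \<in> K"
  shows "card F = card (\<psi> ` F) * card K"
proof (rule card_eq_card_image_mult_fibre [OF assms(1)])
  fix x assume x: "x \<in> F"
  have "{y \<in> F. \<psi> y = \<psi> x} = (+) x ` K"
  proof safe
    fix y assume "y \<in> F" "\<psi> y = \<psi> x"
    then have "y - x \<in> K" "y = x + (y - x)" using assms(4) x by auto
    then show "y \<in> (+) x ` K" by blast
  next
    fix y assume "y \<in> K" then show "x + y \<in> F" "\<psi> (x + y) = \<psi> x"
      using assms(3,4) x by auto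
  qed
  then show "card {y \<in> F. \<psi> y = \<psi> x} = card K" by (simp add: card_image)
qed

text \<open>Coordinates with respect to a basis are arbitrary functions from it to the field. This
  is the only place where the dimension used by \<open>Hilb\<close> is taken apart; afterwards it
  appears just as an exponent of q.\<close>

lemma card_vectorspace:
  fixes V :: "('k::{field,finite}, 'v) module"
  assumes "vectorspace class_ring V" "finite (carrier V)"
  shows "card (carrier V) = CARD('k) ^ vectorspace.dim class_ring V"
proof -
  interpret vectorspace class_ring V by fact
  have "fin_dim" unfolding fin_dim_def
    using assms(2) in_own_span [of "carrier V"] span_is_subset2 [of "carrier V"] by auto
  then obtain \<beta> where \<beta>: "finite \<beta>" "basis \<beta>" using finite_basis_exists by blast
  then have sub: "\<beta> \<subseteq> carrier V" unfolding basis_def by blast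
  have u: "\<exists>!a. a \<in> \<beta> \<rightarrow>\<^sub>E (UNIV :: 'k set) \<and> lincomb a \<beta> = v" if "v \<in> carrier V" for v
    using basis_criterion [OF \<beta>(1) sub] \<beta>(2) that by simp
  have "bij_betw (\<lambda>a. lincomb a \<beta>) (\<beta> \<rightarrow>\<^sub>E (UNIV :: 'k set)) (carrier V)"
    unfolding bij_betw_def inj_on_def
  proof safe
    fix a b assume *: "a \<in> \<beta> \<rightarrow>\<^sub>E (UNIV :: 'k set)" "b \<in> \<beta> \<rightarrow>\<^sub>E (UNIV :: 'k set)" "lincomb a \<beta> = lincomb b \<beta>"
    have "lincomb b \<beta> \<in> carrier V" using sub by (intro lincomb_closed) auto
    from u [OF this] * show "a = b" by blast
  next
    fix a assume "a \<in> \<beta> \<rightarrow>\<^sub>E (UNIV :: 'k set)"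
    show "lincomb a \<beta> \<in> carrier V" using sub by (intro lincomb_closed) auto
  next
    fix v assume "v \<in> carrier V"
    from u [OF this] show "v \<in> (\<lambda>a. lincomb a \<beta>) ` (\<beta> \<rightarrow>\<^sub>E (UNIV :: 'k set))" by blast
  qed
  then have "card (carrier V) = CARD('k) ^ card \<beta>"
    using \<beta>(1) by (simp add: bij_betw_same_card [symmetric] card_PiE)
  then show ?thesis using dim_basis [OF \<beta>] by simp
qed

lemma set_plus_absorb:
  assumes "poly2.subspace N" "A \<subseteq> N" "A \<noteq> {}"
  shows "A + N = N"
proof
  show "A + N \<subseteq> N" using assms(1,2) by (auto simp: set_plus_def intro: poly2.subspace_add)
  show "N \<subseteq> A + N"
  proof
    fix n assume n: "n \<in> N"
    obtain a where "a \<in> A" using assms(3) by blast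
    moreover have "n - a \<in> N" using n \<open>a \<in> A\<close> assms by (auto intro: poly2.subspace_diff)
    ultimately show "n \<in> A + N" using set_plus_intro [of a A "n - a" N] by simp
  qed
qed

lemma elt_set_plus_eq_iff:
  assumes "poly2.subspace N"
  shows "f +o N = g +o N \<longleftrightarrow> f - g \<in> N"
proof
  assume eq: "f +o N = g +o N"
  have "f \<in> f +o N" using poly2.subspace_0 [OF assms] by (auto simp: elt_set_plus_def)
  then obtain n where "n \<in> N" "f = g + n" unfolding eq by (auto simp: elt_set_plus_def)
  then show "f - g \<in> N" by simp
next
  assume fg: "f - g \<in> N"
  show "f +o N = g +o N"
  proof (auto simp: elt_set_plus_def)
    fix n assume "n \<in> N"
    then show "\<exists>n'\<in>N. f + n = g + n'"
      using poly2.subspace_add [OF assms fg] by (intro bexI [of _ "f - g + n"]) auto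
    show "\<exists>n'\<in>N. g + n = f + n'"
      using poly2.subspace_diff [OF assms \<open>n \<in> N\<close> fg] by (intro bexI [of _ "n - (f - g)"]) auto
  qed
qed

lemma elt_set_plus_add:
  assumes "poly2.subspace N"
  shows "(f +o N) + (g +o N) = (f + g) +o N"
proof -
  have "N + N = N" using poly2.subspace_0 [OF assms] by (intro set_plus_absorb [OF assms]) auto
  then show ?thesis by (simp only: set_plus_rearrange)
qed

text \<open>The delicate scalar is c = 0: it collapses a coset to the single element 0, and adding N
  turns this into the zero coset.\<close>

lemma elt_set_plus_scale:
  assumes "poly2.subspace N"
  shows "poly_scale c ` (f +o N) + N = poly_scale c f +o N"
proof -
  have "poly_scale c ` (f +o N) = poly_scale c f +o poly_scale c ` N"
    by (auto simp: elt_set_plus_def poly2.scale_right_distrib image_iff) (metis poly2.scale_right_distrib)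
  moreover have "poly_scale c ` N + N = N"
    using poly2.subspace_0 [OF assms] assms
    by (intro set_plus_absorb) (auto intro: poly2.subspace_scale)
  ultimately show ?thesis by (simp only: set_plus_rearrange3)
qed

lemma vectorspace_coset_space:
  assumes "poly2.subspace N" "poly2.subspace F"
  shows "vectorspace (class_ring :: 'a::field ring) (coset_space N ((\<lambda>f. f +o N) ` F))"
proof -
  note [simp] = elt_set_plus_add [OF assms(1)] elt_set_plus_scale [OF assms(1)]
  have fld: "field (class_ring :: 'a ring)" by (rule class_field)
  have zero: "N \<in> (\<lambda>f. f +o N) ` F"
    using poly2.subspace_0 [OF assms(2)] by (intro image_eqI [of _ _ 0]) simp_all
  have addN [simp]: "(f +o N) + N = f +o N" for f
    using elt_set_plus_add [OF assms(1), of f 0] by simp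
  have neg: "\<exists>g\<in>F. (f + g) +o N = N" if "f \<in> F" for f
    using that poly2.subspace_neg [OF assms(2)] by (intro bexI [of _ "-f"]) auto
  show ?thesis
    unfolding coset_space_def
    apply (rule vs_criteria [OF fld])
               apply (simp_all add: zero)
    subgoal using poly2.subspace_add [OF assms(2)] by force
    subgoal using neg by simp
    subgoal using poly2.subspace_scale [OF assms(2)] by force
    subgoal by (clarsimp simp: add_ac)
    subgoal by (clarsimp simp: add_ac)
    subgoal by clarsimp
    subgoal by clarsimp (simp add: poly2.scale_left_distrib)
    subgoal by clarsimp (simp add: poly2.scale_right_distrib)
    done
qed

text \<open>The quotient map on F has kernel F \<inter> N. Only F is counted, so N may be infinite,
  as the ideal and the span defining cofixed spaces are in general.\<close>

lemma card_coset_space: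
  assumes "poly2.subspace N" "poly2.subspace F" "finite (F :: 'k::{field,finite} poly2 set)"
  shows "CARD('k) ^ vectorspace.dim class_ring (coset_space N ((\<lambda>f. f +o N) ` F)) * card (F \<inter> N)
    = card F"
proof -
  have "card F = card ((\<lambda>f. f +o N) ` F) * card (F \<inter> N)"
    using assms by (intro card_eq_card_image_mult_kernel)
      (auto simp: elt_set_plus_eq_iff intro: poly2.subspace_add poly2.subspace_diff)
  also have "card ((\<lambda>f. f +o N) ` F) =
      CARD('k) ^ vectorspace.dim class_ring (coset_space N ((\<lambda>f. f +o N) ` F))"
    using card_vectorspace [OF vectorspace_coset_space [OF assms(1,2)]] assms(3)
    by (simp add: coset_space_def)
  finally show ?thesis by simp
qed

lemma card_span_independent:
  assumes "finite B" "poly2.independent (B :: 'k::{field,finite} poly2 set)"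
  shows "card (poly2.span B) = CARD('k) ^ card B"
proof -
  have "bij_betw (\<lambda>a. \<Sum>b\<in>B. poly_scale (a b) b) (B \<rightarrow>\<^sub>E (UNIV :: 'k set)) (poly2.span B)"
    unfolding bij_betw_def inj_on_def
  proof safe
    fix a a' assume *: "a \<in> B \<rightarrow>\<^sub>E (UNIV :: 'k set)" "a' \<in> B \<rightarrow>\<^sub>E (UNIV :: 'k set)"
      "(\<Sum>b\<in>B. poly_scale (a b) b) = (\<Sum>b\<in>B. poly_scale (a' b) b)"
    have "(\<Sum>b\<in>B. poly_scale (a b - a' b) b) = 0"
      using *(3) by (simp add: poly2.scale_left_diff_distrib sum_subtractf)
    then have "a b - a' b = 0" if "b \<in> B" for b
      using poly2.independentD [OF assms(2,1), of "\<lambda>b. a b - a' b" b] that by auto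
    with *(1,2) show "a = a'" by (intro PiE_ext [of a B "\<lambda>_. UNIV"]) auto
  next
    fix a show "(\<Sum>b\<in>B. poly_scale (a b) b) \<in> poly2.span B"
      by (intro poly2.span_sum poly2.span_scale poly2.span_base)
  next
    fix f assume "f \<in> poly2.span B"
    then obtain u where "f = (\<Sum>b\<in>B. poly_scale (u b) b)"
      using assms(1) by (auto simp: poly2.span_finite)
    then have "f = (\<Sum>b\<in>B. poly_scale (restrict u B b) b)" by simp
    then show "f \<in> (\<lambda>a. \<Sum>b\<in>B. poly_scale (a b) b) ` (B \<rightarrow>\<^sub>E (UNIV :: 'k set))"
      by (auto intro!: image_eqI [of _ _ "restrict u B"])
  qed
  then show ?thesis using assms(1) by (simp add: bij_betw_same_card [symmetric] card_PiE)
qed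


subsection \<open>Polynomials in two variables\<close>

abbreviation "lookup \<equiv> Poly_Mapping.lookup"
abbreviation "single \<equiv> Poly_Mapping.single"

definition expo :: "nat \<Rightarrow> nat \<Rightarrow> (2 \<Rightarrow>\<^sub>0 nat)" where
  "expo a b = single 1 a + single 2 b"

lemma lookup_expo [simp]: "lookup (expo a b) 1 = a" "lookup (expo a b) 2 = b"
  by (simp_all add: expo_def lookup_add lookup_single when_def)

lemma expo_exhaust: obtains a b where "e = expo a b"
proof
  show "e = expo (lookup e 1) (lookup e 2)"
    by (intro poly_mapping_eqI) (metis exhaust_2 lookup_expo)
qed

lemma expo_eq_iff [simp]: "expo a b = expo c d \<longleftrightarrow> a = c \<and> b = d"
  by (metis lookup_expo)

lemma expo_add: "expo a b + expo c d = expo (a + c) (b + d)"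
  by (simp add: expo_def single_add add_ac)

lemma expo_0: "expo 0 0 = 0"
  by (simp add: expo_def)

lemma prod_UNIV_2: "prod f (UNIV :: 2 set) = f 1 * f 2"
  unfolding UNIV_2 by simp

lemma poly_mapping_eq_sum_single: "f = (\<Sum>e\<in>Poly_Mapping.keys f. single e (lookup f e))"
  by (intro poly_mapping_eqI)
    (simp add: lookup_sum lookup_single when_def in_keys_iff)

lemma poly2_induct [case_names single add]:
  fixes f :: "'k::comm_monoid_add poly2"
  assumes "\<And>a b c. P (single (expo a b) c)" "\<And>f g. P f \<Longrightarrow> P g \<Longrightarrow> P (f + g)"
  shows "P f"
proof -
  have "P (\<Sum>e\<in>A. single e (lookup f e))" if "finite A" for A
    using that
  proof (induction A rule: finite_induct)
    case empty
    then show ?case using assms(1) [of 0 0 0] by simp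
  next
    case (insert e A)
    obtain a b where "e = expo a b" by (rule expo_exhaust)
    then show ?case using insert assms by simp
  qed
  then show ?thesis using poly_mapping_eq_sum_single [of f] by (metis finite_keys)
qed

lemma poly2_eqI:
  assumes "\<And>a b. lookup f (expo a b) = lookup g (expo a b)" shows "f = g"
  by (intro poly_mapping_eqI) (metis assms expo_exhaust)

definition mon :: "nat \<Rightarrow> nat \<Rightarrow> 'k::field poly2" where
  "mon a b = single (expo a b) 1"

lemma lookup_mon: "lookup (mon a b) (expo c d) = (if a = c \<and> b = d then 1 else 0)"
  by (simp add: mon_def lookup_single when_def)

lemma mon_mult: "mon a b * mon c d = mon (a + c) (b + d)"
  by (simp add: mon_def mult_single expo_add)

lemma mon_0: "mon 0 0 = 1"
  by (simp add: mon_def expo_0)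

lemma Var_eq_mon: "Var 1 = mon 1 0" "Var 2 = mon 0 1"
  by (simp_all add: Var_def mon_def expo_def)

lemma mon_power: "mon a b ^ n = mon (n * a) (n * b)"
  by (induction n) (simp_all add: mon_0 mon_mult)

lemma Var_power: "Var 1 ^ n = mon n 0" "Var 2 ^ n = mon 0 n"
  by (simp_all add: Var_eq_mon mon_power)

lemma poly_scale_single: "poly_scale c (single e x) = single e (c * x)"
  by (simp add: poly_scale_def mult_single)

lemma single_eq_scale_mon: "single (expo a b) c = poly_scale c (mon a b)"
  by (simp add: mon_def poly_scale_single)

lemma lookup_scale: "lookup (poly_scale c f) e = c * lookup f e"
proof (induction f rule: poly2_induct)
  case (single a b x)
  then show ?case by (simp add: poly_scale_single lookup_single when_def)
next
  case (add f g)
  then show ?case by (simp add: poly2.scale_right_distrib lookup_add algebra_simps)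
qed

lemma poly_scale_mult_left: "poly_scale c f * g = poly_scale c (f * g)"
  by (simp add: poly_scale_def mult_ac)

lemma poly_scale_mult_right: "f * poly_scale c g = poly_scale c (f * g)"
  by (simp add: poly_scale_def mult_ac)

lemma poly_scale_power: "poly_scale c f ^ n = poly_scale (c ^ n) (f ^ n)"
  by (induction n) (simp_all add: poly_scale_mult_left poly_scale_mult_right)

subsection \<open>Evaluation homomorphisms\<close>

text \<open>Evaluation of polynomials at a pair of points over a homomorphism of coefficients. Three
  instances follow: \<open>const\<close> yields the group action, \<open>constp\<close> yields
  dehomogenization, and \<open>face\<close> yields restriction to the line x_1 = 0.\<close>

locale base_hom =
  fixes \<phi> :: "'k::field \<Rightarrow> 'r::comm_ring_1"
  assumes hom_add: "\<phi> (a + b) = \<phi> a + \<phi> b"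
    and hom_mult: "\<phi> (a * b) = \<phi> a * \<phi> b"
    and hom_one: "\<phi> 1 = 1"
begin

lemma hom_zero: "\<phi> 0 = 0"
  using hom_add [of 0 0] by simp

definition eval2 :: "'r \<Rightarrow> 'r \<Rightarrow> 'k poly2 \<Rightarrow> 'r" where
  "eval2 u v f = (\<Sum>e\<in>Poly_Mapping.keys f. \<phi> (lookup f e) * (u ^ lookup e 1 * v ^ lookup e 2))"

lemma eval2_superset:
  assumes "finite A" "Poly_Mapping.keys f \<subseteq> A"
  shows "eval2 u v f = (\<Sum>e\<in>A. \<phi> (lookup f e) * (u ^ lookup e 1 * v ^ lookup e 2))"
  unfolding eval2_def
  by (rule sum.mono_neutral_left) (use assms in \<open>auto simp: in_keys_iff hom_zero\<close>)

lemma eval2_single: "eval2 u v (single (expo a b) c) = \<phi> c * (u ^ a * v ^ b)"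
  by (simp add: eval2_superset [of "{expo a b}"])

lemma eval2_add: "eval2 u v (f + g) = eval2 u v f + eval2 u v g"
proof -
  let ?A = "Poly_Mapping.keys f \<union> Poly_Mapping.keys g"
  have "Poly_Mapping.keys (f + g) \<subseteq> ?A" by (rule keys_add)
  then show ?thesis
    by (simp add: eval2_superset [of ?A] lookup_add hom_add algebra_simps sum.distrib)
qed

lemma eval2_zero: "eval2 u v 0 = 0"
  by (simp add: eval2_def)

lemma eval2_one: "eval2 u v 1 = 1"
  using eval2_single [of u v 0 0 1] by (simp add: expo_0 hom_one)

lemma eval2_mult: "eval2 u v (f * g) = eval2 u v f * eval2 u v g"
proof (induction f rule: poly2_induct)
  case (single a b c)
  show ?case
  proof (induction g rule: poly2_induct)
    case (single a' b' c')
    then show ?case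
      by (simp add: mult_single expo_add eval2_single hom_mult power_add mult_ac)
  next
    case (add f g)
    then show ?case by (simp add: distrib_left eval2_add)
  qed
next
  case (add f g)
  then show ?case by (simp add: distrib_right eval2_add)
qed

lemma eval2_power: "eval2 u v (f ^ n) = eval2 u v f ^ n"
  by (induction n) (simp_all add: eval2_one eval2_mult)

lemma eval2_uminus: "eval2 u v (- f) = - eval2 u v f"
  using eval2_add [of u v f "- f"] by (simp add: eval2_zero eq_neg_iff_add_eq_0 add.commute)

lemma eval2_diff: "eval2 u v (f - g) = eval2 u v f - eval2 u v g"
  using eval2_add [of u v f "- g"] by (simp add: eval2_uminus)

lemma eval2_sum: "eval2 u v (\<Sum>i\<in>A. f i) = (\<Sum>i\<in>A. eval2 u v (f i))"
  by (induction A rule: infinite_finite_induct) (simp_all add: eval2_zero eval2_add)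

lemma eval2_const: "eval2 u v (single 0 c) = \<phi> c"
  using eval2_single [of u v 0 0 c] by (simp add: expo_0)

lemma eval2_scale: "eval2 u v (poly_scale c f) = \<phi> c * eval2 u v f"
  by (simp add: poly_scale_def eval2_mult eval2_const)

lemma eval2_mon: "eval2 u v (mon a b) = u ^ a * v ^ b"
  by (simp add: mon_def eval2_single hom_one)

end

interpretation const: base_hom "single 0 :: 'k::field \<Rightarrow> 'k poly2"
  by unfold_locales (simp_all add: single_add mult_single)

subsection \<open>The action\<close>

definition lin :: "'k::field \<Rightarrow> 'k \<Rightarrow> 'k poly2" where
  "lin a b = poly_scale a (Var 1) + poly_scale b (Var 2)"

lemma lookup_lin: "lookup (lin a b) (expo c d) = (if c = 1 \<and> d = 0 then a else if c = 0 \<and> d = 1 then b else 0)"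
  by (simp add: lin_def lookup_add lookup_scale Var_eq_mon lookup_mon)

lemma lin_0: "lin a 0 = poly_scale a (Var 1)" "lin 0 a = poly_scale a (Var 2)"
  by (simp_all add: lin_def)

lemma lin_add: "lin a b + lin c d = lin (a + c) (b + d)"
  by (simp add: lin_def poly2.scale_left_distrib)

lemma scale_lin: "poly_scale c (lin a b) = lin (c * a) (c * b)"
  by (simp add: lin_def poly2.scale_right_distrib)

lemma act_eq_eval2: "act g = const.eval2 (lin (g $ 1 $ 1) (g $ 2 $ 1)) (lin (g $ 1 $ 2) (g $ 2 $ 2))"
  by (rule ext) (simp add: act_def const.eval2_def lin_def poly_scale_def sum_2 prod_UNIV_2)

lemma act_add: "act g (f + h) = act g f + act g h"
  by (simp only: act_eq_eval2 const.eval2_add)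

lemma act_diff: "act g (f - h) = act g f - act g h"
  by (simp only: act_eq_eval2 const.eval2_diff)

lemma act_mult: "act g (f * h) = act g f * act g h"
  by (simp only: act_eq_eval2 const.eval2_mult)

lemma act_power: "act g (f ^ n) = act g f ^ n"
  by (simp only: act_eq_eval2 const.eval2_power)

lemma act_zero: "act g 0 = 0"
  by (simp only: act_eq_eval2 const.eval2_zero)

lemma act_scale: "act g (poly_scale c f) = poly_scale c (act g f)"
  by (simp only: act_eq_eval2 poly_scale_def const.eval2_mult const.eval2_const)

lemma act_mon: "act g (mon a b) = lin (g $ 1 $ 1) (g $ 2 $ 1) ^ a * lin (g $ 1 $ 2) (g $ 2 $ 2) ^ b"
  by (simp only: act_eq_eval2 const.eval2_mon)

lemma act_lin: "act g (lin a b) = lin (a * g $ 1 $ 1 + b * g $ 1 $ 2) (a * g $ 2 $ 1 + b * g $ 2 $ 2)"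
proof -
  have "act g (lin a b) = poly_scale a (lin (g $ 1 $ 1) (g $ 2 $ 1)) + poly_scale b (lin (g $ 1 $ 2) (g $ 2 $ 2))"
    by (simp add: lin_def [of a b] act_add act_scale Var_eq_mon act_mon)
  then show ?thesis by (simp add: scale_lin lin_add)
qed

text \<open>On linear forms the action multiplies the coefficient vector by g from the left, and x_j
  goes to column j. Applying g to the columns of h gives the columns of the product, so this is a
  left action.\<close>

lemma act_act: "act g (act h f) = act (g ** h) f"
proof (induction f rule: poly2_induct)
  case (single a b c)
  have "act g (lin (h $ 1 $ j) (h $ 2 $ j)) = lin ((g ** h) $ 1 $ j) ((g ** h) $ 2 $ j)" for j
    by (simp add: act_lin matrix_matrix_mult_def sum_2 mult.commute)
  then show ?case
    by (simp add: single_eq_scale_mon act_scale act_mon act_mult act_power)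
next
  case (add f g)
  then show ?case by (simp add: act_add)
qed

lemma act_id: "act (Finite_Cartesian_Product.mat 1) f = f"
proof (induction f rule: poly2_induct)
  case (single a b c)
  then show ?case
    by (simp add: single_eq_scale_mon act_scale act_mon Finite_Cartesian_Product.mat_def lin_0 Var_power mon_mult)
next
  case (add f g)
  then show ?case by (simp add: act_add)
qed

lemma invertible_act:
  assumes "invertible g"
  obtains h where "\<And>f. act g (act h f) = f" "\<And>f. act h (act g f) = f"
proof -
  obtain h where "g ** h = Finite_Cartesian_Product.mat 1" "h ** g = Finite_Cartesian_Product.mat 1"
    using assms unfolding invertible_def by blast
  then show ?thesis using that [of h] by (simp add: act_act act_id)
qed

lemma homogeneous_iff: "f \<in> homogeneous d \<longleftrightarrow> (\<forall>a b. lookup f (expo a b) \<noteq> 0 \<longrightarrow> a + b = d)"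
proof -
  have "lookup e 1 + lookup e 2 = d"
    if "\<forall>a b. lookup f (expo a b) \<noteq> 0 \<longrightarrow> a + b = d" "lookup f e \<noteq> 0" for e
  proof -
    obtain a b where "e = expo a b" by (rule expo_exhaust)
    with that show ?thesis by simp
  qed
  moreover have "a + b = d"
    if "\<forall>e. lookup f e \<noteq> 0 \<longrightarrow> lookup e 1 + lookup e 2 = d" "lookup f (expo a b) \<noteq> 0" for a b
    using that(1) [rule_format, OF that(2)] by simp
  ultimately show ?thesis
    unfolding homogeneous_def mem_Collect_eq sum_2 in_keys_iff Ball_def by blast
qed

lemma subspace_homogeneous: "poly2.subspace (homogeneous d)"
  unfolding poly2.subspace_def
proof (intro conjI ballI allI)
  fix f g :: "'a poly2" assume fg: "f \<in> homogeneous d" "g \<in> homogeneous d"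
  then show "f + g \<in> homogeneous d"
    unfolding homogeneous_iff lookup_add by (metis add_cancel_right_left)
qed (simp_all add: homogeneous_iff lookup_scale)

lemma mon_homogeneous: "mon a b \<in> homogeneous (a + b)"
  by (simp add: homogeneous_iff lookup_mon)

lemma lin_homogeneous: "lin a b \<in> homogeneous 1"
  by (auto simp: homogeneous_iff lookup_lin split: if_splits)

lemma homogeneous_induct [consumes 1, case_names mon add scale]:
  assumes "f \<in> homogeneous d"
    and "\<And>a b. a + b = d \<Longrightarrow> P (mon a b)" "\<And>f g. P f \<Longrightarrow> P g \<Longrightarrow> P (f + g)" "\<And>c f. P f \<Longrightarrow> P (poly_scale c f)"
  shows "P f"
proof -
  have "P (\<Sum>e\<in>A. single e (lookup f e))" if "finite A" "A \<subseteq> Poly_Mapping.keys f" for A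
    using that
  proof (induction A rule: finite_induct)
    case empty
    \<comment> \<open>The zero polynomial is obtained as 0 times the monomial x_1^d.\<close>
    then show ?case using assms(4) [OF assms(2) [of d 0], of 0] by simp
  next
    case (insert e A)
    obtain a b where e: "e = expo a b" by (rule expo_exhaust)
    with insert assms(1) have "a + b = d" by (auto simp: homogeneous_iff in_keys_iff)
    with e insert show ?case by (auto simp: single_eq_scale_mon intro!: assms)
  qed
  then show ?thesis using poly_mapping_eq_sum_single [of f] by (metis finite_keys order_refl)
qed

lemma homogeneous_mult:
  assumes "f \<in> homogeneous d" "g \<in> homogeneous e" shows "f * g \<in> homogeneous (d + e)"
  using assms(1)
proof (induction f rule: homogeneous_induct)
  case (mon a b)
  show ?case using assms(2)
  proof (induction g rule: homogeneous_induct)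
    case (mon a' b')
    have "a + a' + (b + b') = d + e" using mon \<open>a + b = d\<close> by simp
    then show ?case using mon_homogeneous [of "a + a'" "b + b'"] by (simp add: mon_mult)
  qed (auto simp: distrib_left poly_scale_mult_right
      intro: poly2.subspace_add poly2.subspace_scale subspace_homogeneous)
qed (auto simp: distrib_right poly_scale_mult_left
      intro: poly2.subspace_add poly2.subspace_scale subspace_homogeneous)

lemma homogeneous_power: "f \<in> homogeneous d \<Longrightarrow> f ^ n \<in> homogeneous (n * d)"
proof (induction n)
  case 0
  then show ?case using mon_homogeneous [of 0 0] by (simp add: mon_0)
next
  case (Suc n)
  then have "f * f ^ n \<in> homogeneous (d + n * d)" by (intro homogeneous_mult)
  then show ?case by simp
qed

lemma act_homogeneous:
  assumes "f \<in> homogeneous d" shows "act g f \<in> homogeneous d"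
  using assms
proof (induction f rule: homogeneous_induct)
  case (mon a b)
  then show ?case
    using homogeneous_mult [OF homogeneous_power [OF lin_homogeneous, of _ _ a]
      homogeneous_power [OF lin_homogeneous, of _ _ b]]
    by (simp add: act_mon)
qed (auto simp: act_add act_scale intro: poly2.subspace_add poly2.subspace_scale subspace_homogeneous)

lemma finite_homogeneous: "finite (homogeneous d :: 'k::{field,finite} poly2 set)"
proof -
  define r where "r = (\<lambda>f :: 'k poly2. restrict (\<lambda>i. lookup f (expo (d - i) i)) {..d})"
  have "inj_on r (homogeneous d)"
  proof (rule inj_onI)
    fix f g :: "'k poly2"
    assume fg: "f \<in> homogeneous d" "g \<in> homogeneous d" "r f = r g"
    show "f = g"
    proof (rule poly2_eqI)
      fix a b
      show "lookup f (expo a b) = lookup g (expo a b)"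
      proof (cases "a + b = d")
        case True
        then show ?thesis using fun_cong [OF fg(3), of b] by (auto simp: r_def)
      next
        case False
        then show ?thesis using fg(1,2) unfolding homogeneous_iff by metis
      qed
    qed
  qed
  moreover have "r ` homogeneous d \<subseteq> {..d} \<rightarrow>\<^sub>E (UNIV :: 'k set)"
    unfolding r_def by (intro image_subsetI) (simp add: restrict_PiE_iff)
  ultimately show ?thesis by (rule inj_on_finite) (simp add: finite_PiE)
qed


subsection \<open>Frobenius powers\<close>

text \<open>Multiplication by c \<noteq> 0 permutes the nonzero elements; comparing their products
  gives c^(q-1) = 1.\<close>

lemma finite_field_power_card: "(c :: 'k::{field,finite}) ^ CARD('k) = c"
proof (cases "c = 0")
  case False
  have "(\<Prod>x\<in>UNIV - {0}. c * x) = (\<Prod>x\<in>UNIV - {0 :: 'k}. x)"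
    by (rule prod.reindex_bij_witness [of _ "\<lambda>x. x / c" "\<lambda>x. c * x"]) (use False in auto)
  then have pow: "c ^ card (UNIV - {0 :: 'k}) = 1"
    by (auto simp: prod.distrib)
  have card: "CARD('k) = Suc (card (UNIV - {0 :: 'k}))"
    by (rule card.remove) auto
  show ?thesis by (simp only: card power_Suc pow mult_1_right)
qed simp

lemma finite_field_power_card_power: "(c :: 'k::{field,finite}) ^ (CARD('k) ^ m) = c"
proof (induction m)
  case (Suc m)
  then show ?case by (simp only: power_Suc power_mult finite_field_power_card)
qed simp

lemma finite_field_power_pred:
  assumes "c \<noteq> (0 :: 'k::{field,finite})" shows "c ^ (CARD('k) ^ m - 1) = 1"
proof -
  obtain k where k: "CARD('k) ^ m = Suc k" by (metis gr0_implies_Suc zero_less_card_finite zero_less_power)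
  have "c * c ^ k = c * 1"
    using finite_field_power_card_power [of c m] unfolding k by simp
  with assms show ?thesis by (simp add: k)
qed

lemma CARD_field_ge_2: "2 \<le> CARD('k::{field,finite})"
proof -
  have "card {0, 1 :: 'k} \<le> CARD('k)" by (rule card_mono) auto
  then show ?thesis by simp
qed

text \<open>The binomial coefficients vanish since \<open>(x + 1)\<^sup>q - x\<^sup>q - 1\<close> has degree less than \<open>q\<close> but
  \<open>q\<close> roots.\<close>

lemma of_nat_binomial_CARD:
  assumes "0 < i" "i < CARD('k::{field,finite})"
  shows "of_nat (CARD('k) choose i) = (0 :: 'k)"
proof -
  let ?q = "CARD('k)"
  define P :: "'k poly" where "P = (\<Sum>i\<in>{1..<?q}. monom (of_nat (?q choose i)) i)"
  have deg: "degree P < ?q"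
    unfolding P_def using CARD_field_ge_2 [where 'k = 'k]
    by (intro degree_lessI) (auto simp: coeff_sum)
  have "poly P x = 0" for x
  proof -
    have set: "{..?q} = insert 0 (insert ?q {1..<?q})" by auto
    have "x + 1 = (x + 1) ^ ?q" by (simp add: finite_field_power_card)
    also have "\<dots> = (\<Sum>k\<le>?q. of_nat (?q choose k) * x ^ k)"
      by (simp add: binomial_ring)
    also have "\<dots> = 1 + x + poly P x"
      unfolding set using CARD_field_ge_2 [where 'k = 'k]
      by (simp add: P_def poly_sum poly_monom finite_field_power_card)
    finally show ?thesis by simp
  qed
  then have "P = 0"
    using deg card_poly_roots_bound [of P] by fastforce
  then have "coeff P i = 0" by simp
  then show ?thesis using assms by (simp add: P_def coeff_sum)
qed

lemma poly2_add_power_CARD: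
  fixes f g :: "'k::{field,finite} poly2"
  shows "(f + g) ^ (CARD('k) ^ m) = f ^ (CARD('k) ^ m) + g ^ (CARD('k) ^ m)"
proof -
  let ?q = "CARD('k)"
  have "(f + g) ^ ?q = f ^ ?q + g ^ ?q" for f g :: "'k poly2"
  proof -
    have set: "{..?q} = insert 0 (insert ?q {1..<?q})" by auto
    have z: "of_nat (?q choose i) = (0 :: 'k poly2)" if "i \<in> {1..<?q}" for i
    proof -
      have "of_nat (?q choose i) = (single 0 (of_nat (?q choose i)) :: 'k poly2)"
        by (rule single_of_nat [symmetric])
      also have "\<dots> = 0" using of_nat_binomial_CARD [of i, where 'k = 'k] that by simp
      finally show ?thesis .
    qed
    have "(f + g) ^ ?q = (\<Sum>k\<le>?q. of_nat (?q choose k) * f ^ k * g ^ (?q - k))"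
      by (rule binomial_ring)
    also have "\<dots> = f ^ ?q + g ^ ?q"
      unfolding set using CARD_field_ge_2 [where 'k = 'k] by (simp add: z)
    finally show ?thesis .
  qed
  note q = this
  show ?thesis
  proof (induction m arbitrary: f g)
    case (Suc m)
    then show ?case by (simp only: power_Suc power_mult q)
  qed simp
qed

text \<open>Raising to the power Q is additive and fixes the scalars. Hence linear substitutions
  over the ground field send x_i^Q to combinations of x_1^Q and x_2^Q, which is why the ideal is
  stable.\<close>

lemma lin_power_CARD:
  "lin a b ^ (CARD('k) ^ m) =
    poly_scale a (mon (CARD('k) ^ m) 0) + poly_scale b (mon 0 (CARD('k) ^ m) :: 'k::{field,finite} poly2)"
  by (simp add: lin_def poly2_add_power_CARD poly_scale_power finite_field_power_card_power Var_power)


lemma lookup_mon_mult: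
  "lookup (mon c d * f) (expo a b) = (if c \<le> a \<and> d \<le> b then lookup f (expo (a - c) (b - d)) else 0)"
proof (induction f rule: poly2_induct)
  case (single x y z)
  then show ?case by (auto simp: mon_def mult_single expo_add lookup_single when_def)
next
  case (add f g)
  then show ?case by (simp add: distrib_left lookup_add)
qed

lemma frobenius_power_altdef:
  "(frobenius_power Q :: 'k::field poly2 set) = {a * mon Q 0 + b * mon 0 Q | a b. True}"
proof (intro equalityI subsetI)
  fix f :: "'k poly2" assume "f \<in> frobenius_power Q"
  then show "f \<in> {a * mon Q 0 + b * mon 0 Q | a b. True}"
    by (auto simp: frobenius_power_def sum_2 Var_power)
next
  fix f :: "'k poly2" assume "f \<in> {a * mon Q 0 + b * mon 0 Q | a b. True}"
  then obtain a b where f: "f = a * mon Q 0 + b * mon 0 Q" by blast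
  then have "f = (\<Sum>i\<in>UNIV. (if i = 1 then a else b) * Var i ^ Q)"
    by (simp add: sum_2 Var_power)
  then show "f \<in> frobenius_power Q" unfolding frobenius_power_def by (intro CollectI exI conjI TrueI)
qed

lemma subspace_frobenius_power: "poly2.subspace (frobenius_power Q :: 'k::field poly2 set)"
  unfolding poly2.subspace_def
proof (intro conjI ballI allI)
  show "(0 :: 'k poly2) \<in> frobenius_power Q"
    unfolding frobenius_power_altdef by (auto intro!: exI [of _ 0])
next
  fix f g :: "'k poly2" assume "f \<in> frobenius_power Q" "g \<in> frobenius_power Q"
  then obtain a b c d where "f = a * mon Q 0 + b * mon 0 Q" "g = c * mon Q 0 + d * mon 0 Q"
    unfolding frobenius_power_altdef by auto
  then have "f + g = (a + c) * mon Q 0 + (b + d) * mon 0 Q" by (simp add: algebra_simps)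
  then show "f + g \<in> frobenius_power Q" unfolding frobenius_power_altdef by blast
next
  fix c :: 'k and f :: "'k poly2" assume "f \<in> frobenius_power Q"
  then obtain a b where "f = a * mon Q 0 + b * mon 0 Q"
    unfolding frobenius_power_altdef by auto
  then have "poly_scale c f = poly_scale c a * mon Q 0 + poly_scale c b * mon 0 Q"
    by (simp add: poly2.scale_right_distrib poly_scale_mult_left)
  then show "poly_scale c f \<in> frobenius_power Q" unfolding frobenius_power_altdef by blast
qed

lemma frobenius_power_mult:
  assumes "f \<in> frobenius_power Q" shows "h * f \<in> frobenius_power Q"
proof -
  obtain a b where "f = a * mon Q 0 + b * mon 0 Q"
    using assms unfolding frobenius_power_altdef by auto
  then have "h * f = (h * a) * mon Q 0 + (h * b) * mon 0 Q" by (simp add: algebra_simps)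
  then show ?thesis unfolding frobenius_power_altdef by blast
qed

lemma mon_in_frobenius_power: "mon Q 0 \<in> frobenius_power Q" "mon 0 Q \<in> frobenius_power Q"
proof -
  have "mon Q 0 = 1 * mon Q 0 + 0 * mon 0 Q" "mon 0 Q = 0 * mon Q 0 + 1 * mon 0 Q" by simp_all
  then show "mon Q 0 \<in> frobenius_power Q" "mon 0 Q \<in> frobenius_power Q"
    unfolding frobenius_power_altdef by blast+
qed

lemma frobenius_power_iff:
  "f \<in> frobenius_power Q \<longleftrightarrow> (\<forall>a b. lookup f (expo a b) \<noteq> 0 \<longrightarrow> Q \<le> a \<or> Q \<le> b)"
proof
  assume "f \<in> frobenius_power Q"
  then obtain c d where "f = mon Q 0 * c + mon 0 Q * d"
    unfolding frobenius_power_altdef by (auto simp: mult.commute)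
  then show "\<forall>a b. lookup f (expo a b) \<noteq> 0 \<longrightarrow> Q \<le> a \<or> Q \<le> b"
    by (auto simp: lookup_add lookup_mon_mult)
next
  assume *: "\<forall>a b. lookup f (expo a b) \<noteq> 0 \<longrightarrow> Q \<le> a \<or> Q \<le> b"
  have "single e (lookup f e) \<in> frobenius_power Q" if "e \<in> Poly_Mapping.keys f" for e
  proof -
    obtain a b where e: "e = expo a b" by (rule expo_exhaust)
    have "mon a b \<in> frobenius_power Q"
    proof (cases "Q \<le> a")
      case True
      then have "mon a b = mon (a - Q) b * mon Q 0" by (simp add: mon_mult)
      then show ?thesis using frobenius_power_mult mon_in_frobenius_power by metis
    next
      case False
      then have "Q \<le> b" using * that by (auto simp: e in_keys_iff)
      then have "mon a b = mon a (b - Q) * mon 0 Q" by (simp add: mon_mult)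
      then show ?thesis using frobenius_power_mult mon_in_frobenius_power by metis
    qed
    then show ?thesis
      unfolding e single_eq_scale_mon by (rule poly2.subspace_scale [OF subspace_frobenius_power])
  qed
  then have "(\<Sum>e\<in>Poly_Mapping.keys f. single e (lookup f e)) \<in> frobenius_power Q"
    by (rule poly2.subspace_sum [OF subspace_frobenius_power])
  then show "f \<in> frobenius_power Q" by (simp flip: poly_mapping_eq_sum_single)
qed

lemma act_frobenius_power:
  assumes "(f :: 'k::{field,finite} poly2) \<in> frobenius_power (CARD('k) ^ m)"
  shows "act g f \<in> frobenius_power (CARD('k) ^ m)"
proof -
  let ?Q = "CARD('k) ^ m"
  obtain a b where f: "f = a * mon ?Q 0 + b * mon 0 ?Q"
    using assms unfolding frobenius_power_altdef by auto
  have "act g (mon ?Q 0) \<in> frobenius_power ?Q" "act g (mon 0 ?Q) \<in> frobenius_power ?Q"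
    by (simp_all add: act_mon lin_power_CARD poly2.subspace_add poly2.subspace_scale
        subspace_frobenius_power mon_in_frobenius_power)
  then show ?thesis
    unfolding f act_add act_mult
    by (intro poly2.subspace_add [OF subspace_frobenius_power] frobenius_power_mult)
qed

lemma add_power_eq_power_add_mult: "\<exists>r. (A + B) ^ n = B ^ n + A * r" for A B :: "'a::comm_ring_1"
proof (induction n)
  case 0
  show ?case by (rule exI [of _ 0]) simp
next
  case (Suc n)
  then obtain r where "(A + B) ^ n = B ^ n + A * r" by blast
  then have "(A + B) ^ Suc n = B ^ Suc n + A * (B ^ n + (A + B) * r)"
    by (simp add: algebra_simps)
  then show ?case by blast
qed

text \<open>The top degree of S/I is a line on which g acts by det(g)^(Q-1) = 1. The proof makes
  this explicit by eliminating one linear form with the other modulo the ideal.\<close>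

lemma act_socle_monomial:
  fixes g :: "'k::{field,finite}^2^2"
  assumes "invertible g" and Q: "Q = CARD('k) ^ m"
  shows "act g (mon (Q - 1) (Q - 1)) - mon (Q - 1) (Q - 1) \<in> frobenius_power Q"
proof -
  define n where "n = Q - 1"
  have Qn: "Q = Suc n" using Q by (simp add: n_def)
  note sub = poly2.subspace_add [OF subspace_frobenius_power] poly2.subspace_scale [OF subspace_frobenius_power]
  have unit: "c ^ n = 1" if "c \<noteq> 0" for c :: 'k
    using finite_field_power_pred [OF that, of m] by (simp add: n_def Q)
  have X: "mon n 0 * mon 0 n = (mon n n :: 'k poly2)" by (simp add: mon_mult)
  define a b c d where abcd: "a = g $ 1 $ 1" "b = g $ 1 $ 2" "c = g $ 2 $ 1" "d = g $ 2 $ 2"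
  have det: "a * d - b * c \<noteq> 0"
    using assms(1) unfolding invertible_det_nz by (simp add: det_2 abcd)
  have act: "act g (mon n n) = lin a c ^ n * lin b d ^ n" by (simp add: act_mon abcd)
  show ?thesis
  proof (cases "a = 0")
    case False
    \<comment> \<open>One column operation: subtracting s times the first image leaves t x_2, where
      t is det(g) / a and thus nonzero.\<close>
    define s t where "s = b / a" and "t = d - b * c / a"
    have t: "t \<noteq> 0" using det False by (simp add: t_def field_simps)
    have "lin b d = poly_scale s (lin a c) + lin 0 t"
      using False by (simp add: scale_lin lin_add s_def t_def)
    then obtain r where r: "lin b d ^ n = lin 0 t ^ n + poly_scale s (lin a c) * r"
      using add_power_eq_power_add_mult by metis
    have "lin a c = lin 0 c + lin a 0" by (simp add: lin_add)
    then obtain r' where r': "lin a c ^ n = lin a 0 ^ n + lin 0 c * r'"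
      using add_power_eq_power_add_mult by metis
    have x: "lin a 0 ^ n = mon n 0" "lin 0 t ^ n = mon 0 n"
      using False t by (simp_all add: lin_0 poly_scale_power unit Var_power)
    \<comment> \<open>The error term carries one more factor \<open>lin a c\<close>, which completes
      the n-th power to a Q-th power, an element of the ideal.\<close>
    have "lin a c ^ n * lin b d ^ n = lin a c ^ n * lin 0 t ^ n + poly_scale s (r * lin a c ^ Q)"
      unfolding r by (simp add: algebra_simps poly_scale_mult_left poly_scale_mult_right Qn)
    also have "lin a c ^ n * lin 0 t ^ n = mon n n + poly_scale c (r' * mon 0 Q)"
      unfolding r' x
      by (simp add: algebra_simps lin_0 poly_scale_mult_left poly_scale_mult_right X Qn Var_eq_mon mon_mult)
    finally have "act g (mon n n) - mon n n
        = poly_scale c (r' * mon 0 Q) + poly_scale s (r * lin a c ^ Q)"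
      by (simp add: act)
    also have "\<dots> \<in> frobenius_power Q"
      unfolding Q lin_power_CARD by (intro sub frobenius_power_mult mon_in_frobenius_power)
    finally show ?thesis by (simp add: n_def)
  next
    case True
    then have bc: "b \<noteq> 0" "c \<noteq> 0" using det by auto
    have "lin b d = lin 0 d + lin b 0" by (simp add: lin_add)
    then obtain r where r: "lin b d ^ n = lin b 0 ^ n + lin 0 d * r"
      using add_power_eq_power_add_mult by metis
    have x: "lin a c ^ n = mon 0 n" "lin b 0 ^ n = mon n 0"
      using True bc by (simp_all add: lin_0 poly_scale_power unit Var_power)
    have "act g (mon n n) = mon n n + poly_scale d (r * mon 0 Q)"
      unfolding act r x
      by (simp add: algebra_simps lin_0 poly_scale_mult_left poly_scale_mult_right X Qn Var_eq_mon mon_mult)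
    then have "act g (mon n n) - mon n n = poly_scale d (r * mon 0 Q)" by simp
    also have "\<dots> \<in> frobenius_power Q"
      by (intro sub frobenius_power_mult mon_in_frobenius_power)
    finally show ?thesis by (simp add: n_def)
  qed
qed

text \<open>By linearity only monomials matter: outside the top degree both coefficients vanish, and
  in the top degree every monomial other than the socle monomial lies in the stable ideal.\<close>

lemma lookup_act_socle:
  fixes f :: "'k::{field,finite} poly2"
  assumes "invertible g" and Q: "Q = CARD('k) ^ m"
  shows "lookup (act g f) (expo (Q - 1) (Q - 1)) = lookup f (expo (Q - 1) (Q - 1))"
proof (induction f rule: poly2_induct)
  case (add f g)
  then show ?case by (simp add: act_add lookup_add)
next
  case (single a b c)
  define n where "n = Q - 1"
  have Qn: "Q = Suc n" using Q by (simp add: n_def)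
  have I: "lookup h (expo n n) = 0" if "h \<in> frobenius_power Q" for h :: "'k poly2"
    using that Qn unfolding frobenius_power_iff by (meson not_less_eq_eq order_refl)
  have "lookup (act g (mon a b)) (expo n n) = lookup (mon a b) (expo n n)"
  proof (cases "a + b = 2 * n")
    case False
    have "act g (mon a b) \<in> homogeneous (a + b)" by (intro act_homogeneous mon_homogeneous)
    with False have "lookup (act g (mon a b)) (expo n n) = 0" unfolding homogeneous_iff by fastforce
    with False show ?thesis by (auto simp: lookup_mon)
  next
    case True
    show ?thesis
    proof (cases "a = n")
      case True
      then show ?thesis
        using I [OF act_socle_monomial [OF assms]] \<open>a + b = 2 * n\<close> by (simp add: n_def lookup_minus)
    next
      case False
      \<comment> \<open>The exponents sum to 2n without both being n, so one of them is at least n +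
        1 = Q.\<close>
      then have "mon a b \<in> (frobenius_power Q :: 'k poly2 set)"
        using True Qn by (auto simp: frobenius_power_iff lookup_mon split: if_splits)
      then show ?thesis using I act_frobenius_power unfolding Q by metis
    qed
  qed
  then show ?case by (simp add: single_eq_scale_mon act_scale lookup_scale n_def)
qed

subsection \<open>Duality\<close>

lemma act_image_coset:
  fixes g :: "'k::{field,finite}^2^2"
  assumes "invertible g" and Q: "Q = CARD('k) ^ m"
  shows "act g ` (f +o frobenius_power Q) = act g f +o frobenius_power Q"
proof -
  obtain h where h: "\<And>f. act g (act h f) = f" using invertible_act [OF assms(1)] by metis
  show ?thesis
  proof (intro equalityI subsetI)
    fix x assume "x \<in> act g ` (f +o frobenius_power Q)"
    then show "x \<in> act g f +o frobenius_power Q"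
      using act_frobenius_power unfolding Q by (auto simp: elt_set_plus_def act_add)
  next
    fix x assume "x \<in> act g f +o frobenius_power Q"
    then obtain y where y: "y \<in> frobenius_power Q" "x = act g f + y" by (auto simp: elt_set_plus_def)
    then have "x = act g (f + act h y)" "act h y \<in> frobenius_power Q"
      using act_frobenius_power unfolding Q by (auto simp: act_add h)
    then show "x \<in> act g ` (f +o frobenius_power Q)" by (auto simp: elt_set_plus_def)
  qed
qed

text \<open>The preimage in S_d of the fixed space of the quotient. Representatives are easier to
  count and to pair than cosets.\<close>

definition fixed_modulo :: "('k::field^2^2) set \<Rightarrow> nat \<Rightarrow> nat \<Rightarrow> 'k poly2 set" where
  "fixed_modulo G Q d = {f \<in> homogeneous d. \<forall>g\<in>G. act g f - f \<in> frobenius_power Q}"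

lemma subspace_fixed_modulo: "poly2.subspace (fixed_modulo G Q d)"
  unfolding poly2.subspace_def
proof (intro conjI ballI allI)
  show "0 \<in> fixed_modulo G Q d"
    by (simp add: fixed_modulo_def act_zero poly2.subspace_0 subspace_homogeneous subspace_frobenius_power)
next
  fix f f' assume *: "f \<in> fixed_modulo G Q d" "f' \<in> fixed_modulo G Q d"
  have "act g (f + f') - (f + f') \<in> frobenius_power Q" if "g \<in> G" for g
  proof -
    have "act g (f + f') - (f + f') = (act g f - f) + (act g f' - f')" by (simp add: act_add)
    also have "\<dots> \<in> frobenius_power Q"
      using * that by (intro poly2.subspace_add subspace_frobenius_power) (simp_all add: fixed_modulo_def)
    finally show ?thesis .
  qed
  with * show "f + f' \<in> fixed_modulo G Q d"
    by (simp add: fixed_modulo_def poly2.subspace_add subspace_homogeneous)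
next
  fix c f assume *: "f \<in> fixed_modulo G Q d"
  have "act g (poly_scale c f) - poly_scale c f \<in> frobenius_power Q" if "g \<in> G" for g
  proof -
    have "act g (poly_scale c f) - poly_scale c f = poly_scale c (act g f - f)"
      by (simp add: act_scale poly2.scale_right_diff_distrib)
    also have "\<dots> \<in> frobenius_power Q"
      using * that by (intro poly2.subspace_scale subspace_frobenius_power) (simp_all add: fixed_modulo_def)
    finally show ?thesis .
  qed
  with * show "poly_scale c f \<in> fixed_modulo G Q d"
    by (simp add: fixed_modulo_def poly2.subspace_scale subspace_homogeneous)
qed

lemma finite_fixed_modulo: "finite (fixed_modulo G Q d :: 'k::{field,finite} poly2 set)"
  unfolding fixed_modulo_def by (rule finite_subset [OF _ finite_homogeneous]) auto

lemma fixed_quotient_eq: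
  fixes G :: "('k::{field,finite}^2^2) set"
  assumes "\<And>g. g \<in> G \<Longrightarrow> invertible g" and "Q = CARD('k) ^ m"
  shows "fixed_quotient G (frobenius_power Q) d =
    coset_space (frobenius_power Q) ((\<lambda>f. f +o frobenius_power Q) ` fixed_modulo G Q d)"
proof -
  have "(\<forall>g\<in>G. act g ` (f +o frobenius_power Q) = f +o frobenius_power Q) \<longleftrightarrow>
    (\<forall>g\<in>G. act g f - f \<in> frobenius_power Q)" for f
    using assms by (simp add: act_image_coset elt_set_plus_eq_iff [OF subspace_frobenius_power])
  then show ?thesis
    unfolding fixed_quotient_def quotient_degree_def fixed_modulo_def
    by (intro arg_cong [of _ _ "coset_space _"]) blast
qed

lemma card_fixed_quotient:
  fixes G :: "('k::{field,finite}^2^2) set"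
  assumes "\<And>g. g \<in> G \<Longrightarrow> invertible g" and "Q = CARD('k) ^ m"
  shows "CARD('k) ^ vectorspace.dim class_ring (fixed_quotient G (frobenius_power Q) d)
      * card (fixed_modulo G Q d \<inter> frobenius_power Q) = card (fixed_modulo G Q d)"
  by (subst (1) fixed_quotient_eq [OF assms], assumption)
   (rule card_coset_space [OF subspace_frobenius_power subspace_fixed_modulo finite_fixed_modulo])

lemma card_cofixed:
  fixes G :: "('k::{field,finite}^2^2) set"
  shows "CARD('k) ^ vectorspace.dim class_ring (cofixed G d)
      * card (homogeneous d \<inter> poly2.span {act g f - f | g f. g \<in> G})
    = card (homogeneous d :: 'k poly2 set)"
  unfolding cofixed_def Let_def quotient_degree_def
  by (rule card_coset_space [OF poly2.subspace_span subspace_homogeneous finite_homogeneous])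

text \<open>A nonzero coefficient at x_1^a x_2^b with a, b \<le> n is detected by the complementary
  monomial with exponents n - a and n - b, whose degree is exactly e.\<close>

lemma socle_pairing_nondegenerate:
  assumes "h \<in> homogeneous (2 * n - e)" "e \<le> n"
    and "\<And>f. f \<in> homogeneous e \<Longrightarrow> lookup (f * h) (expo n n) = 0"
  shows "h \<in> frobenius_power (Suc n)"
  unfolding frobenius_power_iff
proof (intro allI impI, rule ccontr)
  fix a b assume *: "lookup h (expo a b) \<noteq> 0" "\<not> (Suc n \<le> a \<or> Suc n \<le> b)"
  then have "a + b = 2 * n - e" using assms(1) by (auto simp: homogeneous_iff)
  then have "n - a + (n - b) = e" using * assms(2) by simp
  then have "lookup (mon (n - a) (n - b) * h) (expo n n) = 0"
    using assms(3) mon_homogeneous by metis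
  then show False using * by (simp add: lookup_mon_mult)
qed

text \<open>For g' inverse to g, the product g(f) h equals g(f g'(h)), whose top coefficient is that
  of f g'(h). Modulo the ideal g'(h) is h, and the ideal contributes nothing to the top
  coefficient.\<close>

lemma socle_pairing_cofixed:
  fixes G :: "('k::{field,finite}^2^2) set"
  assumes "\<And>g. g \<in> G \<Longrightarrow> invertible g" and Q: "Q = CARD('k) ^ m"
    and h: "h \<in> fixed_modulo G Q d" and f: "f \<in> poly2.span {act g f - f | g f. g \<in> G}"
  shows "lookup (f * h) (expo (Q - 1) (Q - 1)) = 0"
  using f
proof (induction f rule: poly2.span_induct_alt)
  case base
  then show ?case by simp
next
  case (step c x y)
  then obtain g f where gf: "g \<in> G" "x = act g f - f" by blast
  obtain g' where g': "\<And>f. act g (act g' f) = f" "\<And>f. act g' (act g f) = f"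
    using invertible_act assms(1) [OF gf(1)] by metis
  have "act g h - h \<in> frobenius_power Q" using h gf by (auto simp: fixed_modulo_def)
  from poly2.subspace_neg [OF subspace_frobenius_power act_frobenius_power [OF this [unfolded Q], of g']]
  have "act g' h - h \<in> frobenius_power Q" by (simp add: act_diff g' Q)
  then have "f * (act g' h - h) \<in> frobenius_power Q" by (rule frobenius_power_mult)
  moreover have "0 < Q" using Q by simp
  then have "\<not> Q \<le> Q - 1" by linarith
  ultimately have 0: "lookup (f * (act g' h - h)) (expo (Q - 1) (Q - 1)) = 0"
    unfolding frobenius_power_iff by metis
  have "act g f * h = act g (f * act g' h)" by (simp add: act_mult g')
  then have "lookup (act g f * h) (expo (Q - 1) (Q - 1)) = lookup (f * act g' h) (expo (Q - 1) (Q - 1))"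
    using lookup_act_socle [OF assms(1) [OF gf(1)] Q] by simp
  with 0 have "lookup (x * h) (expo (Q - 1) (Q - 1)) = 0"
    by (simp add: gf algebra_simps lookup_minus)
  with step show ?case by (simp add: distrib_right lookup_add poly_scale_mult_left lookup_scale)
qed

text \<open>The coefficients of h are the prescribed values, placed at the complementary exponents.
  The bound e \<le> n ensures that every monomial of degree e, including x_1^e and x_2^e, has such a
  complement.\<close>

lemma exists_socle_pairing_functional:
  fixes \<phi> :: "'k::field poly2 \<Rightarrow> 'k"
  assumes "\<And>f g. \<phi> (f + g) = \<phi> f + \<phi> g" "\<And>c f. \<phi> (poly_scale c f) = c * \<phi> f" "e \<le> n"
  obtains h where "h \<in> homogeneous (2 * n - e)"
    "\<And>f. f \<in> homogeneous e \<Longrightarrow> lookup (f * h) (expo n n) = \<phi> f"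
proof
  define h where "h = (\<Sum>i\<le>e. single (expo (n - (e - i)) (n - i)) (\<phi> (mon (e - i) i)))"
  have "single (expo (n - (e - i)) (n - i)) c \<in> homogeneous (2 * n - e)" if "i \<le> e" for i and c :: 'k
  proof -
    have "n - (e - i) + (n - i) = 2 * n - e" using that assms(3) by simp
    then show ?thesis
      unfolding single_eq_scale_mon
      by (metis mon_homogeneous poly2.subspace_scale subspace_homogeneous)
  qed
  then show "h \<in> homogeneous (2 * n - e)"
    unfolding h_def by (intro poly2.subspace_sum subspace_homogeneous) simp
  fix f :: "'k poly2" assume "f \<in> homogeneous e"
  then show "lookup (f * h) (expo n n) = \<phi> f"
  proof (induction f rule: homogeneous_induct)
    case (mon a b)
    have "lookup (mon a b * h) (expo n n) = lookup h (expo (n - a) (n - b))"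
      using mon assms(3) by (simp add: lookup_mon_mult)
    also have "\<dots> = (\<Sum>i\<le>e. if i = b then \<phi> (mon (e - i) i) else 0)"
      unfolding h_def lookup_sum
      by (intro sum.cong) (use mon assms(3) in \<open>auto simp: lookup_single when_def\<close>)
    also have "\<dots> = \<phi> (mon a b)" using mon by auto
    finally show ?case .
  qed (simp_all add: assms distrib_right lookup_add poly_scale_mult_left lookup_scale)
qed

lemma poly2_linear_extend:
  assumes "poly2.independent B"
  obtains \<phi> :: "'k::field poly2 \<Rightarrow> 'k" where "\<And>f g. \<phi> (f + g) = \<phi> f + \<phi> g"
    "\<And>c f. \<phi> (poly_scale c f) = c * \<phi> f" "\<And>b. b \<in> B \<Longrightarrow> \<phi> b = c b"
proof -
  interpret ks: Vector_Spaces.vector_space "(*) :: 'k \<Rightarrow> 'k \<Rightarrow> 'k"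
    by unfold_locales (simp_all add: algebra_simps)
  interpret vector_space_pair "poly_scale :: 'k \<Rightarrow> 'k poly2 \<Rightarrow> 'k poly2" "(*) :: 'k \<Rightarrow> 'k \<Rightarrow> 'k" ..
  obtain \<phi> where "Vector_Spaces.linear poly_scale (*) \<phi>" "\<forall>b\<in>B. \<phi> b = c b"
    using linear_independent_extend [OF assms] by blast
  then show ?thesis
    by (intro that [of \<phi>] linear_add linear_scale) auto
qed

text \<open>Pairing identifies F / (F \<inter> I) with the functionals on S_e that vanish on S_e
  \<inter> N. Both dimensions equal the number of basis vectors needed to extend a basis of S_e
  \<inter> N to one of S_e.\<close>

theorem dim_fixed_quotient_eq_dim_cofixed:
  fixes G :: "('k::{field,finite}^2^2) set"
  assumes G: "\<And>g. g \<in> G \<Longrightarrow> invertible g" and Q: "Q = CARD('k) ^ m" and "e < Q"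
  shows "vectorspace.dim class_ring (fixed_quotient G (frobenius_power Q) (2 * (Q - 1) - e))
    = vectorspace.dim class_ring (cofixed G e)" (is "?dF = ?dC")
proof -
  let ?q = "CARD('k)"
  define n where "n = Q - 1"
  have Qn: "Q = Suc n" and en: "e \<le> n" using \<open>e < Q\<close> by (auto simp: n_def)
  define I where "I = (frobenius_power Q :: 'k poly2 set)"
  define N where "N = poly2.span {act g f - f | g f. g \<in> G}"
  define S where "S = (homogeneous e :: 'k poly2 set)"
  define F where "F = fixed_modulo G Q (2 * n - e)"
  define top where "top f = lookup f (expo n n)" for f :: "'k poly2"
  have S: "poly2.subspace S" "finite S" unfolding S_def by (rule subspace_homogeneous finite_homogeneous)+
  have I: "poly2.subspace I" unfolding I_def by (rule subspace_frobenius_power)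
  have F: "poly2.subspace F" "finite F" unfolding F_def
    by (rule subspace_fixed_modulo finite_fixed_modulo)+
  have W: "poly2.subspace (S \<inter> N)" using S(1) unfolding N_def
    by (intro poly2.subspace_inter poly2.subspace_span)
  \<comment> \<open>The elements of B outside \<open>BW\<close> represent a basis of the cofixed
    space in degree e.\<close>
  obtain BW where BW: "BW \<subseteq> S \<inter> N" "poly2.independent BW" "S \<inter> N \<subseteq> poly2.span BW"
    by (rule poly2.maximal_independent_subset)
  obtain B where B: "BW \<subseteq> B" "B \<subseteq> S" "poly2.independent B" "S \<subseteq> poly2.span B"
    using poly2.maximal_independent_subset_extend [of BW S] BW by auto
  have finB: "finite B" "finite BW"
    by (rule finite_subset [OF B(2) S(2)], rule finite_subset [OF order_trans [OF B(1,2)] S(2)])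
  have spB: "poly2.span B = S"
    by (rule equalityI [OF poly2.span_minimal [OF B(2) S(1)] B(4)])
  have spBW: "poly2.span BW = S \<inter> N"
    by (rule equalityI [OF poly2.span_minimal [OF BW(1) W] BW(3)])
  have cards: "card S = ?q ^ card B" "card (S \<inter> N) = ?q ^ card BW"
    using card_span_independent [OF finB(1) B(3)] card_span_independent [OF finB(2) BW(2)]
    unfolding spB spBW .
  have card_B: "card B = card (B - BW) + card BW"
    using finB B(1) by (simp add: card_Diff_subset card_mono)
  have top_add: "top (f + f') = top f + top f'" and top_diff: "top (f - f') = top f - top f'"
    and top_scale: "top (poly_scale c f) = c * top f" for f f' c
    by (simp_all add: top_def lookup_add lookup_minus lookup_scale)
  have topI: "top (f * h) = 0" if "h \<in> I" for f h
    using frobenius_power_mult [OF that [unfolded I_def], of f] Qn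
    unfolding frobenius_power_iff top_def by (meson not_less_eq_eq order_refl)
  have nondeg: "h \<in> I" if "h \<in> homogeneous (2 * n - e)" "\<And>f. f \<in> S \<Longrightarrow> top (f * h) = 0" for h
    using socle_pairing_nondegenerate [OF that(1) en] that(2) unfolding I_def S_def Qn top_def by blast
  have topN: "top (f * h) = 0" if "h \<in> F" "f \<in> N" for f h
    using socle_pairing_cofixed [OF G Q] that unfolding F_def N_def top_def n_def by blast
  have FS: "h \<in> homogeneous (2 * n - e)" if "h \<in> F" for h
    using that by (simp add: F_def fixed_modulo_def)

  \<comment> \<open>Coordinates of the functional that h induces on the cofixed space; on
    \<open>BW\<close> every element of F pairs to 0 anyway.\<close>
  define \<psi> where "\<psi> h = restrict (\<lambda>b. top (b * h)) (B - BW)" for h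
  have "card F = card (\<psi> ` F) * card (F \<inter> I)"
  proof (rule card_eq_card_image_mult_kernel)
    fix x y assume xy: "x \<in> F" "y \<in> F"
    then have yx: "y - x \<in> F" by (intro poly2.subspace_diff F)
    show "\<psi> y = \<psi> x \<longleftrightarrow> y - x \<in> F \<inter> I"
    proof
      assume eq: "\<psi> y = \<psi> x"
      have topB: "top (b * (y - x)) = 0" if "b \<in> B" for b
      proof (cases "b \<in> BW")
        case True
        then show ?thesis using BW(1) topN [OF yx] by auto
      next
        case False
        then have "top (b * y) = top (b * x)" using fun_cong [OF eq, of b] that by (simp add: \<psi>_def)
        then show ?thesis by (simp add: right_diff_distrib top_diff)
      qed
      have "top (f * (y - x)) = 0" if "f \<in> poly2.span B" for f
        using that
      proof (induction f rule: poly2.span_induct_alt)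
        case base
        then show ?case by (simp add: top_def)
      next
        case (step c b f)
        then show ?case by (simp add: topB distrib_right top_add poly_scale_mult_left top_scale)
      qed
      then show "y - x \<in> F \<inter> I" using nondeg [OF FS [OF yx]] yx unfolding spB by blast
    next
      assume "y - x \<in> F \<inter> I"
      then have "top (b * y) = top (b * x)" for b
        using topI [of "y - x" b] by (simp add: right_diff_distrib top_diff)
      then show "\<psi> y = \<psi> x" by (simp add: \<psi>_def)
    qed
  qed (use F in \<open>auto intro: poly2.subspace_add\<close>)
  moreover have "\<psi> ` F = (B - BW) \<rightarrow>\<^sub>E UNIV"
  proof (intro equalityI subsetI)
    fix c assume "c \<in> \<psi> ` F"
    then obtain h where "c = \<psi> h" by blast
    then show "c \<in> (B - BW) \<rightarrow>\<^sub>E UNIV" by (simp only: \<psi>_def restrict_PiE_iff UNIV_I ball_triv simp_thms)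
  next
    fix c :: "'k poly2 \<Rightarrow> 'k" assume c: "c \<in> (B - BW) \<rightarrow>\<^sub>E UNIV"
    \<comment> \<open>Extension by 0 on \<open>BW\<close> makes the functional vanish on S_e
      \<inter> N, which is what forces the representing h to be fixed modulo I.\<close>
    obtain \<phi> where \<phi>: "\<And>f g. \<phi> (f + g) = \<phi> f + \<phi> g" "\<And>a f. \<phi> (poly_scale a f) = a * \<phi> f"
      "\<And>b. b \<in> B \<Longrightarrow> \<phi> b = (if b \<in> BW then 0 else c b)"
      using poly2_linear_extend [OF B(3), of "\<lambda>b. if b \<in> BW then 0 else c b"] by metis
    obtain h where h: "h \<in> homogeneous (2 * n - e)" "\<And>f. f \<in> S \<Longrightarrow> top (f * h) = \<phi> f"
      using exists_socle_pairing_functional [OF \<phi>(1,2) en] unfolding S_def top_def by metis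
    have \<phi>0: "\<phi> 0 = 0" using \<phi>(2) [of 0 0] by simp
    have \<phi>N: "\<phi> f = 0" if "f \<in> poly2.span BW" for f
      using that B(1) by (induction f rule: poly2.span_induct_alt) (auto simp: \<phi> \<phi>0)
    have "act g h - h \<in> I" if g: "g \<in> G" for g
    proof (rule nondeg)
      show "act g h - h \<in> homogeneous (2 * n - e)"
        by (intro poly2.subspace_diff subspace_homogeneous act_homogeneous h)
      fix f assume f: "f \<in> S"
      obtain g' where g': "\<And>f. act g (act g' f) = f" using invertible_act G [OF g] by metis
      have f': "act g' f \<in> S" using f unfolding S_def by (rule act_homogeneous)
      have "f - act g' f \<in> N" unfolding N_def
        by (rule poly2.span_base, rule CollectI, rule exI [of _ g], rule exI [of _ "act g' f"])
          (simp add: g' g)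
      moreover have "f - act g' f \<in> S" using f f' S by (intro poly2.subspace_diff)
      ultimately have "\<phi> (f - act g' f) = 0" using \<phi>N unfolding spBW by blast
      moreover have "\<phi> f = \<phi> (f - act g' f) + \<phi> (act g' f)" using \<phi>(1) [of "f - act g' f" "act g' f"] by simp
      ultimately have "\<phi> f = \<phi> (act g' f)" by simp
      moreover have "f * act g h = act g (act g' f * h)" by (simp add: act_mult g')
      then have "top (f * act g h) = top (act g' f * h)"
        using lookup_act_socle [OF G [OF g] Q] by (simp add: top_def n_def)
      ultimately show "top (f * (act g h - h)) = 0"
        using h(2) f f' by (simp add: right_diff_distrib top_diff)
    qed
    then have "h \<in> F" using h(1) by (simp add: F_def fixed_modulo_def I_def)
    moreover have "\<psi> h = c"
    proof
      fix b show "\<psi> h b = c b"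
        using c B(2) h(2) \<phi>(3) by (cases "b \<in> B - BW") (auto simp: \<psi>_def PiE_def extensional_def)
    qed
    ultimately show "c \<in> \<psi> ` F" by blast
  qed
  ultimately have card_F: "card F = ?q ^ card (B - BW) * card (F \<inter> I)"
    using finB by (simp add: card_PiE)
  have "0 \<in> F \<inter> I" using poly2.subspace_0 F(1) I by blast
  then have FI: "card (F \<inter> I) \<noteq> 0" using F(2) by auto
  have "?q ^ ?dF * card (F \<inter> I) = card F"
    using card_fixed_quotient [OF G Q] unfolding F_def I_def n_def by blast
  then have 1: "?q ^ ?dF = ?q ^ card (B - BW)" using card_F FI by simp
  have "?q ^ ?dC * card (S \<inter> N) = card S"
    using card_cofixed [of G e] unfolding S_def N_def by blast
  then have "?q ^ ?dC = ?q ^ card (B - BW)" unfolding cards card_B by (simp add: power_add)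
  with 1 have "?q ^ ?dF = ?q ^ ?dC" by simp
  then show ?thesis using CARD_field_ge_2 [where 'k = 'k] by (simp add: power_inject_exp)
qed


section \<open>Dehomogenization and restriction to the line x_1 = 0\<close>

interpretation constp: base_hom "\<lambda>c :: 'k::field. [:c:]"
  by unfold_locales (simp_all add: one_pCons)

interpretation face: base_hom "\<lambda>c :: 'k::field. c"
  by unfold_locales simp_all

abbreviation dehom :: "'k::field poly2 \<Rightarrow> 'k poly" where "dehom \<equiv> constp.eval2 1 [:0, 1:]"

text \<open>For homogeneous f of degree d this is the coefficient of x_2^d, so it vanishes exactly
  if x_1 divides f.\<close>

abbreviation face :: "'k::field poly2 \<Rightarrow> 'k" where "face \<equiv> face.eval2 0 1"

lemma dehom_mon: "dehom (mon a b) = monom 1 b"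
  by (simp add: constp.eval2_mon monom_altdef)

lemma dehom_lin: "dehom (lin a b) = [:a, b:]"
  by (simp add: lin_def Var_eq_mon constp.eval2_add constp.eval2_scale dehom_mon monom_altdef)

lemma face_eq_lookup: "f \<in> homogeneous d \<Longrightarrow> face f = lookup f (expo 0 d)"
proof (induction f rule: homogeneous_induct)
  case (mon a b)
  then show ?case by (auto simp: face.eval2_mon lookup_mon power_0_left)
qed (simp_all add: face.eval2_add face.eval2_scale lookup_add lookup_scale)

lemma coeff_dehom:
  assumes "f \<in> homogeneous d"
  shows "coeff (dehom f) i = (if i \<le> d then lookup f (expo (d - i) i) else 0)"
  using assms
proof (induction f rule: homogeneous_induct)
  case (mon a b)
  then show ?case by (auto simp: dehom_mon lookup_mon)
qed (simp_all add: constp.eval2_add constp.eval2_scale lookup_add lookup_scale)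

lemma degree_dehom: "f \<in> homogeneous d \<Longrightarrow> degree (dehom f) \<le> d"
  by (rule degree_le) (simp add: coeff_dehom)

lemma dehom_inject:
  assumes "f \<in> homogeneous d" "g \<in> homogeneous d" "dehom f = dehom g"
  shows "f = g"
proof (rule poly2_eqI)
  fix a b
  show "lookup f (expo a b) = lookup g (expo a b)"
  proof (cases "a + b = d")
    case True
    then show ?thesis
      using coeff_dehom [OF assms(1), of b] coeff_dehom [OF assms(2), of b] assms(3) by auto
  next
    case False
    then show ?thesis using assms(1,2) unfolding homogeneous_iff by metis
  qed
qed

definition homogenize :: "nat \<Rightarrow> 'k::field poly \<Rightarrow> 'k poly2" where
  "homogenize d p = (\<Sum>i\<le>d. poly_scale (coeff p i) (mon (d - i) i))"

lemma homogenize_homogeneous: "homogenize d p \<in> homogeneous d"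
  unfolding homogenize_def
  by (intro poly2.subspace_sum poly2.subspace_scale subspace_homogeneous)
    (metis atMost_iff le_add_diff_inverse2 mon_homogeneous)

lemma dehom_homogenize: "degree p \<le> d \<Longrightarrow> dehom (homogenize d p) = p"
  by (intro poly_eqI)
    (auto simp: homogenize_def constp.eval2_sum constp.eval2_scale dehom_mon coeff_sum coeff_eq_0 mult_delta_right)

text \<open>Division is carried out in one variable and then homogenized. Dehomogenization forgets
  powers of x_1; the degree bound on r guarantees that enough of them are left over in f.\<close>

lemma homogeneous_eq_mult:
  assumes "f \<in> homogeneous d" "u \<in> homogeneous a" "dehom f = dehom u * r" "degree r + a \<le> d"
  shows "homogenize (d - a) r \<in> homogeneous (d - a)" "f = u * homogenize (d - a) r"
proof -
  show *: "homogenize (d - a) r \<in> homogeneous (d - a)" by (rule homogenize_homogeneous)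
  have "u * homogenize (d - a) r \<in> homogeneous d"
    using homogeneous_mult [OF assms(2) *] assms(4) by simp
  moreover have "dehom (u * homogenize (d - a) r) = dehom f"
    using assms(3,4) by (simp add: constp.eval2_mult dehom_homogenize)
  ultimately show "f = u * homogenize (d - a) r" using dehom_inject assms(1) by metis
qed


subsection \<open>Univariate polynomials over a finite field\<close>

text \<open>The linear factors for different c are coprime: the part already split off has order 0
  at the next c, so the full multiplicity there falls on the cofactor.\<close>

lemma prod_linear_power_dvd:
  fixes p :: "'k::field poly"
  assumes "finite A" "\<And>c. c \<in> A \<Longrightarrow> [:- c, 1:] ^ n dvd p"
  shows "(\<Prod>c\<in>A. [:- c, 1:]) ^ n dvd p"
  using assms
proof (induction A rule: finite_induct)
  case (insert c A)
  then obtain r where r: "p = (\<Prod>c\<in>A. [:- c, 1:]) ^ n * r" by (auto elim: dvdE)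
  show ?case
  proof (cases "p = 0")
    case False
    have "poly ((\<Prod>c\<in>A. [:- c, 1:]) ^ n) c \<noteq> 0"
      using insert.hyps by (auto simp: poly_prod)
    then have "Polynomial.order c ((\<Prod>c\<in>A. [:- c, 1:]) ^ n) = 0" by (rule order_0I)
    moreover have "n \<le> Polynomial.order c p" using insert.prems False by (simp add: order_divides)
    ultimately have "n \<le> Polynomial.order c r" using r False by (simp add: order_mult)
    then have "[:- c, 1:] ^ n dvd r" by (simp add: order_divides)
    then have "[:- c, 1:] ^ n * (\<Prod>c\<in>A. [:- c, 1:]) ^ n dvd r * (\<Prod>c\<in>A. [:- c, 1:]) ^ n"
      by (rule mult_dvd_mono) simp
    then show ?thesis
      by (simp only: prod.insert [OF insert.hyps] power_mult_distrib r mult.commute [of _ r])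
  qed simp
qed simp

text \<open>Every c is a root of the right-hand side, so the product divides it; both are monic of
  degree q.\<close>

lemma prod_linear_UNIV:
  "(\<Prod>c\<in>UNIV. [:- c, 1:]) = monom 1 CARD('k) - [:0, 1 :: 'k::{field,finite}:]"
proof -
  let ?q = "CARD('k)"
  let ?P = "\<Prod>c\<in>UNIV. [:- c, 1 :: 'k:]"
  define R where "R = monom 1 ?q - [:0, 1 :: 'k:]"
  have q: "2 \<le> ?q" by (rule CARD_field_ge_2)
  have cR: "coeff R i = (if i = ?q then 1 else 0) - (if i = 1 then 1 else 0)" for i
    by (auto simp: R_def coeff_pCons split: nat.splits)
  have dR: "degree R = ?q"
    by (intro antisym degree_le le_degree) (use q in \<open>auto simp: cR\<close>)
  then have R0: "R \<noteq> 0" using q by auto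
  have "[:- c, 1:] ^ 1 dvd R" for c
    by (simp add: R_def poly_monom finite_field_power_card flip: poly_eq_0_iff_dvd)
  then have "?P ^ 1 dvd R" by (intro prod_linear_power_dvd) auto
  then obtain s where s: "R = ?P * s" by (auto elim: dvdE)
  have dP: "degree ?P = ?q" by (simp add: degree_prod_eq_sum_degree)
  have lP: "lead_coeff ?P = 1" by (simp add: lead_coeff_prod)
  have nz: "?P \<noteq> 0" "s \<noteq> 0" using s R0 by auto
  then have "degree s = 0" using s dR dP degree_mult_eq [of ?P s] by simp
  then obtain k where k: "s = [:k:]" by (rule degree_eq_zeroE)
  have "lead_coeff R = k" using lP unfolding s by (simp add: lead_coeff_mult k)
  moreover have "lead_coeff R = 1" using q by (simp add: dR cR)
  ultimately show ?thesis using s k by (simp add: R_def one_pCons)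
qed

text \<open>Such a p is a polynomial in X^q - X. The descent: p - p(0) vanishes on the whole field,
  hence is divisible by the product of all X - c, and the quotient is again translation
  invariant.\<close>

lemma CARD_dvd_degree_translation_invariant:
  fixes p :: "'k::{field,finite} poly"
  assumes "\<And>c. p \<circ>\<^sub>p [:c, 1:] = p"
  shows "CARD('k) dvd degree p"
  using assms
proof (induction "degree p" arbitrary: p rule: less_induct)
  case less
  let ?P = "\<Prod>c\<in>UNIV. [:- c, 1 :: 'k:]"
  show ?case
  proof (cases "degree p = 0")
    case False
    define p0 where "p0 = p - [:poly p 0:]"
    have dp0: "degree p0 = degree p" using False
      unfolding p0_def diff_conv_add_uminus by (intro degree_add_eq_left) simp
    have "poly p c = poly p 0" for c
      using arg_cong [OF less.prems [of c], of "\<lambda>r. poly r 0"] by (simp add: poly_pcompose)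
    then have "[:- c, 1:] ^ 1 dvd p0" for c
      by (simp add: p0_def flip: poly_eq_0_iff_dvd)
    then have "?P ^ 1 dvd p0" by (intro prod_linear_power_dvd) auto
    then obtain r where r: "p0 = ?P * r" by (auto elim: dvdE)
    have p00: "p0 \<noteq> 0" using dp0 False by auto
    have dP: "degree ?P = CARD('k)" by (simp add: degree_prod_eq_sum_degree)
    have "degree p0 = degree ?P + degree r"
      unfolding r by (rule degree_mult_eq) (use r p00 in auto)
    then have dr: "degree p = CARD('k) + degree r" using dp0 dP by simp
    have "r \<circ>\<^sub>p [:c, 1:] = r" for c
    proof -
      have "?P \<circ>\<^sub>p [:c, 1:] = (\<Prod>d\<in>UNIV. [:c - d, 1:])"
        by (simp add: pcompose_prod pcompose_pCons)
      also have "\<dots> = ?P"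
        by (rule prod.reindex_bij_witness [of _ "\<lambda>d. c + d" "\<lambda>d. d - c"]) auto
      finally have "?P * (r \<circ>\<^sub>p [:c, 1:]) = p0 \<circ>\<^sub>p [:c, 1:]" by (simp add: r pcompose_mult)
      also have "\<dots> = ?P * r" using less.prems by (simp add: p0_def pcompose_diff flip: r)
      finally show ?thesis using p00 r by auto
    qed
    then have "CARD('k) dvd degree r" using dr by (intro less.hyps) auto
    then show ?thesis by (simp add: dr)
  qed simp
qed

text \<open>Otherwise the remainder r of i modulo q - 1 is positive, and X^r - 1 has q - 1 roots
  although its degree is smaller. This takes the place of the cyclicity of the unit group.\<close>

lemma power_eq_1_imp_dvd:
  assumes "\<And>t :: 'k::{field,finite}. t \<noteq> 0 \<Longrightarrow> t ^ i = 1"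
  shows "CARD('k) - 1 dvd i"
proof (rule ccontr)
  let ?q = "CARD('k)"
  assume "\<not> ?q - 1 dvd i"
  define r where "r = i mod (?q - 1)"
  have r: "0 < r" "r < ?q - 1"
    using \<open>\<not> ?q - 1 dvd i\<close> CARD_field_ge_2 [where 'k = 'k] by (auto simp: r_def dvd_eq_mod_eq_0)
  have t: "t ^ r = 1" if "t \<noteq> 0" for t :: 'k
  proof -
    have "t ^ i = t ^ ((?q - 1) * (i div (?q - 1)) + r)" by (simp add: r_def)
    also have "\<dots> = (t ^ (?q - 1)) ^ (i div (?q - 1)) * t ^ r" by (simp only: power_add power_mult)
    also have "t ^ (?q - 1) = 1" using finite_field_power_pred [OF that, of 1] by simp
    finally show ?thesis using assms [OF that] by simp
  qed
  define P where "P = monom (1 :: 'k) r - 1"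
  have "coeff P r = 1" using r by (simp add: P_def coeff_1)
  then have P: "P \<noteq> 0" by auto
  have "degree P \<le> r" unfolding P_def by (intro degree_diff_le) (auto simp: degree_monom_le)
  moreover have "card (UNIV - {0 :: 'k}) \<le> card {x. poly P x = 0}"
    by (rule card_mono) (auto simp: P_def poly_monom t)
  moreover have "card {x. poly P x = 0} \<le> degree P" using P by (rule card_poly_roots_bound)
  moreover have "card (UNIV - {0 :: 'k}) = ?q - 1" by (simp add: card_Diff_singleton)
  ultimately show False using r by linarith
qed


subsection \<open>Counting invariants\<close>

definition invariants :: "('k::field^2^2) set \<Rightarrow> nat \<Rightarrow> 'k poly2 set" where
  "invariants G d = {f \<in> homogeneous d. \<forall>g\<in>G. act g f = f}"

lemma invariants_0: "0 \<in> invariants G d"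
  by (simp add: invariants_def act_zero poly2.subspace_0 subspace_homogeneous)

lemma invariants_add: "f \<in> invariants G d \<Longrightarrow> h \<in> invariants G d \<Longrightarrow> f + h \<in> invariants G d"
  by (simp add: invariants_def act_add poly2.subspace_add subspace_homogeneous)

lemma invariants_diff: "f \<in> invariants G d \<Longrightarrow> h \<in> invariants G d \<Longrightarrow> f - h \<in> invariants G d"
  by (simp add: invariants_def act_diff poly2.subspace_diff subspace_homogeneous)

lemma invariants_scale: "f \<in> invariants G d \<Longrightarrow> poly_scale c f \<in> invariants G d"
  by (simp add: invariants_def act_scale poly2.subspace_scale subspace_homogeneous)

lemma invariants_mult: "f \<in> invariants G d \<Longrightarrow> h \<in> invariants G e \<Longrightarrow> f * h \<in> invariants G (d + e)"
  by (simp add: invariants_def act_mult homogeneous_mult)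

lemma invariants_power: "f \<in> invariants G d \<Longrightarrow> f ^ n \<in> invariants G (n * d)"
  by (simp add: invariants_def act_power homogeneous_power)

lemma finite_invariants: "finite (invariants G d :: 'k::{field,finite} poly2 set)"
  unfolding invariants_def by (rule finite_subset [OF _ finite_homogeneous]) auto

text \<open>Restriction to x_1 = 0 sends invariants of degree d to scalars. If b divides d,
  multiples of a power of w reach every scalar; otherwise the image is 0. The kernel consists of the
  multiples of u by invariants of degree d - a. This is the count for a polynomial ring in u and
  w.\<close>

lemma card_invariants_recursion:
  fixes G :: "('k::{field,finite}^2^2) set"
  assumes u: "u \<in> invariants G a" "u \<noteq> 0" "face u = 0"
    and w: "w \<in> invariants G b" "face w = 1"
    and dvd_u: "\<And>f. f \<in> invariants G d \<Longrightarrow> face f = 0 \<Longrightarrow> f \<noteq> 0 \<Longrightarrow>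
      a \<le> d \<and> (\<exists>h\<in>homogeneous (d - a). f = u * h)"
    and dvd_b: "\<And>f. f \<in> invariants G d \<Longrightarrow> face f \<noteq> 0 \<Longrightarrow> b dvd d"
  shows "card (invariants G d) =
    (if b dvd d then CARD('k) else 1) * (if a \<le> d then card (invariants G (d - a)) else 1)"
proof -
  define K where "K = {f \<in> invariants G d. face f = 0}"
  have "card (invariants G d) = card (face ` invariants G d) * card K"
    by (rule card_eq_card_image_mult_kernel)
      (auto simp: K_def finite_invariants face.eval2_diff invariants_add invariants_diff)
  moreover have "card (face ` invariants G d) = (if b dvd d then CARD('k) else 1)"
  proof (cases "b dvd d")
    case True
    then obtain k where k: "d = k * b" by (metis dvd_def mult.commute)
    have "c \<in> face ` invariants G d" for c
      by (rule image_eqI [of _ _ "poly_scale c (w ^ k)"])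
        (simp_all add: face.eval2_scale face.eval2_power w k invariants_scale invariants_power)
    then have "face ` invariants G d = UNIV" by auto
    then show ?thesis using True by simp
  next
    case False
    then have "face f = 0" if "f \<in> invariants G d" for f using dvd_b that by blast
    moreover have "0 \<in> face ` invariants G d"
      by (rule image_eqI [of _ _ 0]) (simp_all add: face.eval2_zero invariants_0)
    ultimately have "face ` invariants G d = {0}" by auto
    then show ?thesis using False by simp
  qed
  moreover have "card K = (if a \<le> d then card (invariants G (d - a)) else 1)"
  proof (cases "a \<le> d")
    case True
    have "K = (*) u ` invariants G (d - a)"
    proof (intro equalityI subsetI)
      fix f assume f: "f \<in> K"
      show "f \<in> (*) u ` invariants G (d - a)"
      proof (cases "f = 0")
        case True
        then show ?thesis by (auto intro!: image_eqI [of _ _ 0] simp: invariants_0)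
      next
        case False
        then obtain h where h: "h \<in> homogeneous (d - a)" "f = u * h" using dvd_u f by (auto simp: K_def)
        have "act g h = h" if "g \<in> G" for g
        proof -
          \<comment> \<open>Invariance passes from u h to h by cancelling the invariant nonzero
            factor u.\<close>
          have "u * act g h = u * h"
            using f u that unfolding h(2) by (auto simp: K_def invariants_def act_mult)
          then show ?thesis using u by simp
        qed
        then show ?thesis using h by (auto simp: invariants_def)
      qed
    next
      fix f assume "f \<in> (*) u ` invariants G (d - a)"
      then show "f \<in> K"
        using invariants_mult [OF u(1), of _ "d - a"] True u(3) by (auto simp: K_def face.eval2_mult)
    qed
    moreover have "inj_on ((*) u) (invariants G (d - a))" using u by (auto simp: inj_on_def)
    ultimately show ?thesis using True by (simp add: card_image)
  next
    case False
    then have "K = {0}" using dvd_u by (auto simp: K_def invariants_0 face.eval2_zero)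
    then show ?thesis using False by simp
  qed
  ultimately show ?thesis by simp
qed


subsection \<open>Invariants of parabolic subgroups\<close>

definition mat2 :: "'k::field \<Rightarrow> 'k \<Rightarrow> 'k \<Rightarrow> 'k \<Rightarrow> 'k^2^2" where
  "mat2 a b c d = vector [vector [a, b], vector [c, d]]"

lemma mat2_nth [simp]:
  "mat2 a b c d $ 1 $ 1 = a" "mat2 a b c d $ 1 $ 2 = b" "mat2 a b c d $ 2 $ 1 = c" "mat2 a b c d $ 2 $ 2 = d"
  by (simp_all add: mat2_def)

lemma invertible_mat2: "invertible (mat2 a b c d) \<longleftrightarrow> a * d - b * c \<noteq> 0"
  by (simp add: invertible_det_nz det_2)

definition GL2 :: "('k::field^2^2) set" where "GL2 = {g. invertible g}"

definition borel2 :: "('k::field^2^2) set" where "borel2 = {g. invertible g \<and> g $ 2 $ 1 = 0}"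

lemma borel2_subset_GL2: "borel2 \<subseteq> GL2"
  by (auto simp: borel2_def GL2_def)

lemma lookup_act_diagonal: "lookup (act (mat2 s 0 0 t) f) (expo i j) = s ^ i * t ^ j * lookup f (expo i j)"
proof (induction f rule: poly2_induct)
  case (single a b c)
  then show ?case
    by (auto simp: single_eq_scale_mon act_scale act_mon lin_0 poly_scale_power Var_power
        poly_scale_mult_left poly_scale_mult_right mon_mult lookup_scale lookup_mon)
next
  case (add f g)
  then show ?case by (simp add: act_add lookup_add algebra_simps)
qed

text \<open>Diagonal matrices scale each monomial separately, so every monomial that occurs in f is
  itself fixed by them; one diagonal entry is set to 1 at a time.\<close>

lemma torus_invariant_dvd:
  fixes f :: "'k::{field,finite} poly2"
  assumes "f \<in> invariants G d" "borel2 \<subseteq> G" "lookup f (expo i j) \<noteq> 0"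
  shows "CARD('k) - 1 dvd i" "CARD('k) - 1 dvd j"
proof -
  have inv: "s ^ i * t ^ j = 1" if "s \<noteq> 0" "t \<noteq> 0" for s t :: 'k
  proof -
    have "mat2 s 0 0 t \<in> G" using assms(2) that by (auto simp: borel2_def invertible_mat2)
    then have "act (mat2 s 0 0 t) f = f" using assms(1) by (simp add: invariants_def)
    then show ?thesis using lookup_act_diagonal [of s t f i j] assms(3) by simp
  qed
  show "CARD('k) - 1 dvd i" using inv [of _ 1] by (intro power_eq_1_imp_dvd) simp
  show "CARD('k) - 1 dvd j" using inv [of 1] by (intro power_eq_1_imp_dvd) simp
qed

lemma dehom_act_translation: "dehom (act (mat2 1 c 0 1) f) = dehom f \<circ>\<^sub>p [:c, 1:]"
proof (induction f rule: poly2_induct)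
  case (single a b x)
  have monom: "monom 1 n \<circ>\<^sub>p [:c, 1:] = [:c, 1:] ^ n" for n
    by (induction n) (simp_all add: monom_Suc pcompose_pCons one_pCons)
  have "dehom (act (mat2 1 c 0 1) (mon a b)) = [:1, 0:] ^ a * [:c, 1:] ^ b"
    by (simp only: act_mon mat2_nth constp.eval2_mult constp.eval2_power dehom_lin)
  also have "[:1, 0:] = (1 :: 'a poly)" by (simp add: one_pCons)
  finally show ?case
    by (simp add: single_eq_scale_mon act_scale constp.eval2_scale dehom_mon monom pcompose_smult)
next
  case (add f g)
  then show ?case by (simp add: act_add constp.eval2_add pcompose_add)
qed

text \<open>If x_2^d occurs, the dehomogenization has full degree d. Unipotent matrices act on it as
  translations, so q divides d; the torus gives q - 1, which is coprime to q.\<close>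

lemma borel_invariant_face_dvd:
  fixes f :: "'k::{field,finite} poly2"
  assumes f: "f \<in> invariants G d" and G: "borel2 \<subseteq> G" and "face f \<noteq> 0"
  shows "CARD('k)\<^sup>2 - CARD('k) dvd d"
proof -
  let ?q = "CARD('k)"
  have hom: "f \<in> homogeneous d" using f by (simp add: invariants_def)
  have nz: "lookup f (expo 0 d) \<noteq> 0" using assms(3) face_eq_lookup [OF hom] by simp
  have "degree (dehom f) = d"
    using nz degree_dehom [OF hom] by (intro antisym le_degree) (auto simp: coeff_dehom [OF hom])
  moreover have "dehom f \<circ>\<^sub>p [:c, 1:] = dehom f" for c
  proof -
    have "mat2 1 c 0 1 \<in> G" using G by (auto simp: borel2_def invertible_mat2)
    then show ?thesis using f dehom_act_translation [of c f] by (simp add: invariants_def)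
  qed
  ultimately have "?q dvd d" using CARD_dvd_degree_translation_invariant by metis
  moreover have "?q - 1 dvd d" using torus_invariant_dvd [OF f G nz] by simp
  moreover have "coprime ?q (?q - 1)" using CARD_field_ge_2 [where 'k = 'k]
    by (metis One_nat_def Suc_pred coprime_Suc_left_nat zero_less_card_finite)
  ultimately have "?q * (?q - 1) dvd d" by (intro divides_mult)
  then show ?thesis by (simp add: power2_eq_square algebra_simps)
qed

text \<open>All exponents of x_1 in f are multiples of q - 1, and 0 is excluded because f vanishes
  on x_1 = 0.\<close>

lemma borel_invariant_factor:
  fixes f :: "'k::{field,finite} poly2"
  assumes f: "f \<in> invariants G d" and G: "borel2 \<subseteq> G" and "face f = 0" "f \<noteq> 0"
  shows "CARD('k) - 1 \<le> d" "\<exists>h\<in>homogeneous (d - (CARD('k) - 1)). f = mon (CARD('k) - 1) 0 * h"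
proof -
  let ?n = "CARD('k) - 1"
  have hom: "f \<in> homogeneous d" using f by (simp add: invariants_def)
  have z: "lookup f (expo 0 d) = 0" using assms(3) face_eq_lookup [OF hom] by simp
  have ge: "?n \<le> i" if "lookup f (expo i j) \<noteq> 0" for i j
  proof -
    have "i + j = d" using hom that by (simp add: homogeneous_iff)
    then have "i \<noteq> 0" using that z by (intro notI) simp
    then show ?thesis using torus_invariant_dvd(1) [OF f G that] by (auto intro: dvd_imp_le)
  qed
  have "dehom f \<noteq> 0" using assms(4) dehom_inject [OF hom, of 0]
    by (auto simp: constp.eval2_zero poly2.subspace_0 subspace_homogeneous)
  \<comment> \<open>The leading term of the dehomogenization belongs to the monomial of f with the
    least power of x_1.\<close>
  then have "lead_coeff (dehom f) \<noteq> 0" by simp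
  then have "degree (dehom f) \<le> d" "lookup f (expo (d - degree (dehom f)) (degree (dehom f))) \<noteq> 0"
    using degree_dehom [OF hom] by (auto simp: coeff_dehom [OF hom])
  from this(1) ge [OF this(2)] have le: "degree (dehom f) + ?n \<le> d" by simp
  then show "?n \<le> d" by simp
  have "mon ?n 0 \<in> homogeneous ?n" using mon_homogeneous [of ?n 0] by simp
  from homogeneous_eq_mult [OF hom this, of "dehom f"] le
  show "\<exists>h\<in>homogeneous (d - ?n). f = mon ?n 0 * h" by (auto simp: dehom_mon)
qed

text \<open>The Moore determinant with rows (x_1, x_2) and (x_1^Q, x_2^Q). For Q = q it is the
  product of x_1 and all x_2 - c x_1, one linear form for each line.\<close>

definition alternant :: "nat \<Rightarrow> 'k::field poly2" where
  "alternant Q = mon 1 Q - mon Q 1"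

lemma act_alternant:
  "act g (alternant (CARD('k) ^ m)) = poly_scale (Determinants.det g) (alternant (CARD('k) ^ m) :: 'k::{field,finite} poly2)"
proof -
  let ?Q = "CARD('k) ^ m"
  show ?thesis
    unfolding alternant_def act_diff act_mon power_one_right lin_power_CARD
    by (simp add: lin_def Var_eq_mon mon_mult det_2 distrib_left distrib_right left_diff_distrib
      right_diff_distrib poly_scale_mult_left poly_scale_mult_right poly2.scale_left_diff_distrib
      poly2.scale_right_diff_distrib poly2.scale_right_distrib mult.commute)
qed

lemma alternant_homogeneous: "alternant Q \<in> homogeneous (Q + 1)"
  unfolding alternant_def
  using mon_homogeneous [of 1 Q] mon_homogeneous [of Q 1]
  by (intro poly2.subspace_diff subspace_homogeneous) simp_all

lemma alternant_nonzero: "2 \<le> Q \<Longrightarrow> alternant Q \<noteq> 0"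
proof
  assume "2 \<le> Q" "alternant Q = (0 :: 'a poly2)"
  then have "lookup (alternant Q) (expo 1 Q) = (0 :: 'a)" by simp
  then show False using \<open>2 \<le> Q\<close> by (simp add: alternant_def lookup_minus lookup_mon)
qed

text \<open>The Dickson invariant of degree q^2 - q, which is \<open>alternant (q\<^sup>2)\<close>
  divided by \<open>alternant q\<close>. The geometric sum in x_2^(q-1) and x_1^(q-1) presents this
  quotient as a polynomial.\<close>

definition dickson :: "nat \<Rightarrow> 'k::field poly2" where
  "dickson q = (\<Sum>i<Suc q. mon 0 (q - 1) ^ (q - i) * mon (q - 1) 0 ^ i)"

lemma dickson_alternant:
  assumes "1 \<le> q" shows "dickson q * alternant q = (alternant (q\<^sup>2) :: 'a::field poly2)"
proof -
  define A B where "A = (mon 0 (q - 1) :: 'a poly2)" and "B = (mon (q - 1) 0 :: 'a poly2)"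
  have alt: "alternant q = mon 1 1 * (A - B)"
    using assms by (simp add: alternant_def A_def B_def right_diff_distrib mon_mult)
  have "dickson q * alternant q = mon 1 1 * - ((B - A) * dickson q)"
    unfolding alt by (simp add: algebra_simps)
  also have "(B - A) * dickson q = B ^ Suc q - A ^ Suc q"
    unfolding dickson_def power_diff_sumr2 A_def B_def by (simp only: diff_Suc_Suc)
  also have "mon 1 1 * - (B ^ Suc q - A ^ Suc q) = mon 1 1 * A ^ Suc q - mon 1 1 * B ^ Suc q"
    by (simp add: algebra_simps)
  also have "\<dots> = mon 1 (1 + Suc q * (q - 1)) - mon (1 + Suc q * (q - 1)) 1"
    by (simp only: A_def B_def mon_power mon_mult mult_0_right add_0_right)
  also have "1 + Suc q * (q - 1) = q\<^sup>2"
    using assms by (cases q) (simp_all add: power2_eq_square algebra_simps)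
  finally show ?thesis by (simp only: alternant_def)
qed

text \<open>Both alternants, for q and for q^2, are multiplied by the same factor det(g), so their
  quotient is fixed.\<close>

lemma dickson_invariant:
  assumes "invertible g"
  shows "act g (dickson (CARD('k))) = (dickson (CARD('k)) :: 'k::{field,finite} poly2)"
proof -
  let ?q = "CARD('k)"
  let ?A = "alternant ?q :: 'k poly2" and ?D = "dickson ?q :: 'k poly2"
  have q: "2 \<le> ?q" by (rule CARD_field_ge_2)
  have det: "Determinants.det g \<noteq> 0" using assms by (simp add: invertible_det_nz)
  have "poly_scale (Determinants.det g) (act g ?D * ?A) = act g (?D * ?A)"
    using act_alternant [of g 1] by (simp add: act_mult poly_scale_mult_right)
  also have "\<dots> = poly_scale (Determinants.det g) (?D * ?A)"
    using q act_alternant [of g 2] by (simp add: dickson_alternant)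
  finally have "act g ?D * ?A = ?D * ?A" using det by (simp add: poly2.scale_cancel_left)
  then show ?thesis using alternant_nonzero [OF q, where 'a = 'k] by simp
qed

lemma dickson_in_invariants:
  "(dickson (CARD('k)) :: 'k::{field,finite} poly2) \<in> invariants GL2 (CARD('k)\<^sup>2 - CARD('k))"
proof -
  let ?q = "CARD('k)"
  have "mon 0 (?q - 1) ^ (?q - i) * mon (?q - 1) 0 ^ i \<in> homogeneous (?q\<^sup>2 - ?q)" if "i < Suc ?q" for i
  proof -
    have "i * (?q - 1) + (?q - i) * (?q - 1) = ?q * (?q - 1)"
      using that by (simp only: flip: add_mult_distrib) simp
    also have "\<dots> = ?q\<^sup>2 - ?q" by (simp add: power2_eq_square algebra_simps)
    finally have "i * (?q - 1) + (?q - i) * (?q - 1) = ?q\<^sup>2 - ?q" .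
    then show ?thesis
      using mon_homogeneous [of "i * (?q - 1)" "(?q - i) * (?q - 1)"] by (simp add: mon_power mon_mult)
  qed
  then have "(dickson ?q :: 'k poly2) \<in> homogeneous (?q\<^sup>2 - ?q)"
    unfolding dickson_def by (intro poly2.subspace_sum subspace_homogeneous) auto
  then show ?thesis by (simp add: invariants_def GL2_def dickson_invariant)
qed

lemma face_dickson: "2 \<le> q \<Longrightarrow> face (dickson q) = 1"
  by (simp add: dickson_def face.eval2_sum face.eval2_add face.eval2_mult face.eval2_power face.eval2_mon
      sum.lessThan_Suc_shift power_0_left del: sum.lessThan_Suc)

text \<open>As a Borel invariant, f is divisible by x_1^(q-1). Since \<open>GL2\<close> permutes the
  lines transitively, the same power of each of the q + 1 linear forms divides f, and their product
  is the alternant.\<close>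

lemma GL2_invariant_factor:
  fixes f :: "'k::{field,finite} poly2"
  assumes f: "f \<in> invariants GL2 d" and "face f = 0" "f \<noteq> 0"
  shows "CARD('k)\<^sup>2 - 1 \<le> d \<and>
    (\<exists>h\<in>homogeneous (d - (CARD('k)\<^sup>2 - 1)). f = alternant (CARD('k)) ^ (CARD('k) - 1) * h)"
proof -
  let ?q = "CARD('k)"
  let ?P = "\<Prod>c\<in>UNIV. [:- c, 1 :: 'k:]"
  have q: "2 \<le> ?q" by (rule CARD_field_ge_2)
  have hom: "f \<in> homogeneous d" using f by (simp add: invariants_def)
  note bor = borel_invariant_factor [OF f borel2_subset_GL2 assms(2,3)]
  from bor obtain h where h: "h \<in> homogeneous (d - (?q - 1))" "f = mon (?q - 1) 0 * h" by blast
  have fh: "dehom f = dehom h" by (simp add: h(2) constp.eval2_mult dehom_mon)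
  have "[:- c, 1:] ^ (?q - 1) dvd dehom f" for c
  proof -
    \<comment> \<open>This matrix moves x_1 to x_2 - c x_1, whose dehomogenization is X - c.\<close>
    have "mat2 (- c) 1 1 0 \<in> GL2" by (simp add: GL2_def invertible_mat2)
    then have "f = act (mat2 (- c) 1 1 0) f" using f by (simp add: invariants_def)
    then have "f = lin (- c) 1 ^ (?q - 1) * act (mat2 (- c) 1 1 0) h"
      unfolding h(2) by (simp add: act_mult act_mon)
    from arg_cong [OF this, of dehom] show ?thesis
      by (simp add: constp.eval2_mult constp.eval2_power dehom_lin)
  qed
  then have "?P ^ (?q - 1) dvd dehom f" by (intro prod_linear_power_dvd) auto
  then obtain r where r: "dehom f = ?P ^ (?q - 1) * r" by (auto elim: dvdE)
  have "dehom f \<noteq> 0" using assms(3) dehom_inject [OF hom, of 0]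
    by (auto simp: constp.eval2_zero poly2.subspace_0 subspace_homogeneous)
  then have nz: "?P ^ (?q - 1) \<noteq> 0" "r \<noteq> 0" unfolding r by auto
  have "degree (?P ^ (?q - 1)) = (?q - 1) * ?q"
    using nz(1) by (simp add: degree_power_eq degree_prod_eq_sum_degree)
  then have "(?q - 1) * ?q + degree r = degree (dehom f)"
    unfolding r using nz by (simp add: degree_mult_eq)
  \<comment> \<open>The factor x_1^(q-1) is invisible after dehomogenization; it is recovered
    through this sharper degree bound.\<close>
  also have "\<dots> \<le> d - (?q - 1)" unfolding fh by (rule degree_dehom [OF h(1)])
  finally have "degree r + (?q - 1) * ?q + (?q - 1) \<le> d" using bor(1) by simp
  moreover have sq: "(?q - 1) * (?q + 1) = ?q\<^sup>2 - 1" by (simp add: power2_eq_square algebra_simps)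
  then have "(?q - 1) * ?q + (?q - 1) = ?q\<^sup>2 - 1" by (simp only: add_mult_distrib2 mult_1_right)
  ultimately have le: "degree r + (?q\<^sup>2 - 1) \<le> d" by (simp only: add.assoc)
  have u: "(alternant ?q ^ (?q - 1) :: 'k poly2) \<in> homogeneous (?q\<^sup>2 - 1)"
    unfolding sq [symmetric] by (intro homogeneous_power alternant_homogeneous)
  have "dehom (alternant ?q :: 'k poly2) = ?P"
    unfolding prod_linear_UNIV alternant_def by (simp add: constp.eval2_diff dehom_mon monom_altdef)
  then have "dehom f = dehom (alternant ?q ^ (?q - 1)) * r"
    by (simp only: constp.eval2_power r)
  from homogeneous_eq_mult [OF hom u this le] le show ?thesis by auto
qed

lemma invariants_antimono: "H \<subseteq> G \<Longrightarrow> invariants G d \<subseteq> invariants H d"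
  by (auto simp: invariants_def)

text \<open>The recursion applies with u = x_1^(q-1) and w the Dickson invariant, of degrees q - 1
  and q^2 - q.\<close>

lemma card_invariants_borel2:
  fixes d :: nat
  defines "q \<equiv> CARD('k::{field,finite})"
  shows "card (invariants (borel2 :: ('k^2^2) set) d) =
    (if q\<^sup>2 - q dvd d then q else 1) *
    (if q - 1 \<le> d then card (invariants (borel2 :: ('k^2^2) set) (d - (q - 1))) else 1)"
  unfolding q_def
proof (rule card_invariants_recursion)
  let ?u = "mon (CARD('k) - 1) 0 :: 'k poly2"
  have n: "CARD('k) - 1 \<noteq> 0" using CARD_field_ge_2 [where 'k = 'k] by simp
  have "act g ?u = ?u" if "g \<in> borel2" for g
  proof -
    have "g $ 1 $ 1 \<noteq> 0" using that by (auto simp: borel2_def invertible_det_nz det_2)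
    then show ?thesis
      using that finite_field_power_pred [of "g $ 1 $ 1" 1]
      by (simp add: act_mon borel2_def lin_0 poly_scale_power Var_power)
  qed
  then show "?u \<in> invariants borel2 (CARD('k) - 1)"
    using mon_homogeneous [of "CARD('k) - 1" 0] by (simp add: invariants_def)
  show "?u \<noteq> 0" using lookup_mon [of "CARD('k) - 1" 0 "CARD('k) - 1" 0, where 'a = 'k] by fastforce
  show "face ?u = 0" using n by (simp add: face.eval2_mon power_0_left)
  show "(dickson (CARD('k)) :: 'k poly2) \<in> invariants borel2 (CARD('k)\<^sup>2 - CARD('k))"
    using dickson_in_invariants invariants_antimono [OF borel2_subset_GL2] by blast
  show "face (dickson (CARD('k)) :: 'k poly2) = 1" by (rule face_dickson [OF CARD_field_ge_2])
qed (use borel_invariant_factor borel_invariant_face_dvd in blast)+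

text \<open>Here u is the alternant to the power q - 1, which makes det(g) disappear; its degree is
  (q - 1)(q + 1).\<close>

lemma card_invariants_GL2:
  fixes d :: nat
  defines "q \<equiv> CARD('k::{field,finite})"
  shows "card (invariants (GL2 :: ('k^2^2) set) d) =
    (if q\<^sup>2 - q dvd d then q else 1) *
    (if q\<^sup>2 - 1 \<le> d then card (invariants (GL2 :: ('k^2^2) set) (d - (q\<^sup>2 - 1))) else 1)"
  unfolding q_def
proof (rule card_invariants_recursion)
  let ?q = "CARD('k)"
  let ?u = "alternant ?q ^ (?q - 1) :: 'k poly2"
  have q: "2 \<le> ?q" by (rule CARD_field_ge_2)
  have sq: "(?q - 1) * (?q + 1) = ?q\<^sup>2 - 1" by (simp add: power2_eq_square algebra_simps)
  have "act g ?u = ?u" if "g \<in> GL2" for g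
    using that act_alternant [of g 1] finite_field_power_pred [of "Determinants.det g" 1]
    by (simp add: act_power poly_scale_power GL2_def invertible_det_nz)
  moreover have "?u \<in> homogeneous (?q\<^sup>2 - 1)"
    unfolding sq [symmetric] by (intro homogeneous_power alternant_homogeneous)
  ultimately show "?u \<in> invariants GL2 (?q\<^sup>2 - 1)" by (simp add: invariants_def)
  show "?u \<noteq> 0" using alternant_nonzero [OF q, where 'a = 'k] by simp
  show "face ?u = 0" using q
    by (simp add: face.eval2_power alternant_def face.eval2_diff face.eval2_mon power_0_left)
  show "(dickson ?q :: 'k poly2) \<in> invariants GL2 (?q\<^sup>2 - ?q)" by (rule dickson_in_invariants)
  show "face (dickson ?q :: 'k poly2) = 1" by (rule face_dickson [OF q])
  show "?q\<^sup>2 - ?q dvd d" if "f \<in> invariants GL2 d" "face f \<noteq> 0" for f :: "'k poly2"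
    using borel_invariant_face_dvd [OF that(1) borel2_subset_GL2 that(2)] .
qed (use GL2_invariant_factor in blast)+


section \<open>The two parabolic subgroups, and degrees below Q\<close>

lemma parabolic_2: "parabolic [2] = (GL2 :: ('k::field^2^2) set)"
proof -
  have "block [2] i = 0" for i
    unfolding block_def by (rule Least_equality) (auto simp: position_def)
  then show ?thesis by (simp add: parabolic_def GL2_def)
qed

lemma parabolic_1_1: "parabolic [1, 1] = (borel2 :: ('k::field^2^2) set)"
proof -
  have "block [1, 1] 1 = 0"
    unfolding block_def by (rule Least_equality) (auto simp: position_def)
  moreover have "block [1, 1] 2 = 1"
    unfolding block_def
    by (rule Least_equality) (auto simp: position_def Suc_le_eq intro!: Suc_leI gr0I)
  ultimately show ?thesis by (auto simp: parabolic_def borel2_def forall_2)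
qed

lemma compositions_2: "compositions 2 = {[2], [1, 1]}"
proof -
  have "\<alpha> \<in> {[2], [1, 1]}" if "\<forall>a\<in>set \<alpha>. 0 < a" "sum_list \<alpha> = 2" for \<alpha> :: "nat list"
  proof (cases \<alpha>)
    case (Cons a \<beta>)
    show ?thesis
    proof (cases \<beta>)
      case (Cons b \<gamma>)
      then show ?thesis using that \<open>\<alpha> = a # \<beta>\<close> by (cases \<gamma>) auto
    qed (use that Cons in auto)
  qed (use that in auto)
  then show ?thesis by (auto simp: compositions_def)
qed

lemma fixed_modulo_low_degree:
  fixes G :: "('k::field^2^2) set"
  assumes "d < Q"
  shows "fixed_modulo G Q d = invariants G d" "homogeneous d \<inter> frobenius_power Q = ({0} :: 'k poly2 set)"
proof -
  have zero: "f = 0" if "f \<in> homogeneous d" "f \<in> frobenius_power Q" for f :: "'k poly2"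
  proof (rule poly2_eqI)
    fix a b
    show "lookup f (expo a b) = lookup 0 (expo a b)"
      using that assms unfolding homogeneous_iff frobenius_power_iff by fastforce
  qed
  then show "homogeneous d \<inter> frobenius_power Q = {0 :: 'k poly2}"
    using poly2.subspace_0 [OF subspace_homogeneous] poly2.subspace_0 [OF subspace_frobenius_power] by blast
  have "act g f - f \<in> frobenius_power Q \<longleftrightarrow> act g f = f" if "f \<in> homogeneous d" for g and f :: "'k poly2"
  proof -
    have "act g f - f \<in> homogeneous d"
      using that by (intro poly2.subspace_diff subspace_homogeneous act_homogeneous)
    moreover have "0 \<in> (frobenius_power Q :: 'k poly2 set)"
      by (rule poly2.subspace_0 [OF subspace_frobenius_power])
    ultimately show ?thesis using zero [of "act g f - f"] by auto
  qed
  then show "fixed_modulo G Q d = invariants G d"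
    unfolding fixed_modulo_def invariants_def by auto
qed


subsection \<open>The two families of series\<close>

unbundle fps_syntax
unbundle no vec_syntax

abbreviation geo :: "nat \<Rightarrow> rat fps" where "geo n \<equiv> 1 / (1 - fps_X ^ n)"

lemma fps_nth_one_minus_X_power_mult:
  "((1 - fps_X ^ n) * (F :: 'a::comm_ring_1 fps)) $ d = F $ d - (if d < n then 0 else F $ (d - n))"
  by (simp add: left_diff_distrib fps_X_power_mult_nth)

lemma one_minus_X_power_nth_0: "0 < n \<Longrightarrow> (1 - fps_X ^ n :: rat fps) $ 0 \<noteq> 0"
  by simp

lemma one_minus_X_power_nonzero: "0 < n \<Longrightarrow> (1 - fps_X ^ n :: rat fps) \<noteq> 0"
  by (rule notI, drule arg_cong [of _ _ "\<lambda>F. F $ 0"]) simp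

lemma fps_mult_one_divide: "F * (1 / F) = 1" if "F $ 0 \<noteq> 0" for F :: "'a::field fps"
  by (simp only: fps_divide_unit [OF that] mult_1_left inverse_mult_eq_1' [OF that])

lemma geo_mult: "0 < n \<Longrightarrow> (1 - fps_X ^ n) * geo n = 1"
  by (intro fps_mult_one_divide one_minus_X_power_nth_0)

lemma fps_nth_geo:
  assumes "0 < n"
  shows "geo n $ d = (if n dvd d then 1 else 0)"
proof -
  define G :: "rat fps" where "G = Abs_fps (\<lambda>d. if n dvd d then 1 else 0)"
  have "(1 - fps_X ^ n) * G = 1"
  proof (rule fps_ext)
    fix d show "((1 - fps_X ^ n) * G) $ d = 1 $ d"
      using assms
      by (auto simp: fps_nth_one_minus_X_power_mult G_def dvd_minus_self not_less)
  qed
  then have "geo n = ((1 - fps_X ^ n) * G) / (1 - fps_X ^ n)" by (simp only:)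
  also have "\<dots> = G" by (rule nonzero_mult_div_cancel_left [OF one_minus_X_power_nonzero [OF assms]])
  finally show ?thesis by (simp only: G_def fps_nth_Abs_fps)
qed

definition geo2 :: "nat \<Rightarrow> nat \<Rightarrow> rat fps" where
  "geo2 a b = 1 / ((1 - fps_X ^ a) * (1 - fps_X ^ b))"

lemma geo2_mult:
  assumes "0 < a" "0 < b"
  shows "(1 - fps_X ^ a) * (1 - fps_X ^ b) * geo2 a b = 1"
  unfolding geo2_def
  by (rule fps_mult_one_divide) (simp only: fps_mult_nth_0 mult_eq_0_iff one_minus_X_power_nth_0 assms simp_thms)

lemma geo2_altdef:
  assumes "0 < a" "0 < b"
  shows "geo2 a b = geo a * geo b"
proof -
  have "(1 - fps_X ^ a) * (1 - fps_X ^ b) * (geo a * geo b)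
      = ((1 - fps_X ^ a) * geo a) * ((1 - fps_X ^ b) * geo b)"
    by (simp only: mult_ac)
  also have "\<dots> = 1" using assms by (simp only: geo_mult mult_1)
  finally have "geo2 a b
      = ((1 - fps_X ^ a) * (1 - fps_X ^ b) * (geo a * geo b)) / ((1 - fps_X ^ a) * (1 - fps_X ^ b))"
    by (simp only: geo2_def)
  also have "\<dots> = geo a * geo b"
    by (rule nonzero_mult_div_cancel_left) (simp only: mult_eq_0_iff one_minus_X_power_nonzero assms simp_thms)
  finally show ?thesis .
qed

text \<open>The additive counterpart of the recursion for the number of invariants.\<close>

lemma fps_nth_geo2:
  assumes "0 < a" "0 < b"
  shows "geo2 a b $ d = (if d < a then 0 else geo2 a b $ (d - a)) + (if b dvd d then 1 else 0)"
proof -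
  have "(1 - fps_X ^ a) * geo2 a b = geo b"
    using geo_mult [OF assms(1)] by (simp add: geo2_altdef [OF assms] mult.assoc [symmetric])
  from arg_cong [OF this, of "\<lambda>F. F $ d"] show ?thesis
    by (simp add: fps_nth_one_minus_X_power_mult fps_nth_geo [OF assms(2)] split: if_splits)
qed

lemma fps_nth_geo2_less:
  assumes "0 < a" "d < b"
  shows "geo2 a b $ d = (if a dvd d then 1 else 0)"
  using assms(2)
proof (induction d rule: less_induct)
  case (less d)
  have b: "0 < b" using less.prems by simp
  have bd: "b dvd d \<longleftrightarrow> d = 0" using less.prems by (auto dest: nat_dvd_not_less)
  show ?case
  proof (cases "d < a")
    case True
    then have "a dvd d \<longleftrightarrow> d = 0" by (auto dest: nat_dvd_not_less)
    then show ?thesis using True bd by (subst fps_nth_geo2 [OF assms(1) b]) simp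
  next
    case False
    then have "geo2 a b $ (d - a) = (if a dvd d - a then 1 else 0)"
      using less.prems assms(1) by (intro less.IH) auto
    moreover have "a dvd d - a \<longleftrightarrow> a dvd d" using False by (simp add: dvd_minus_self)
    ultimately show ?thesis using False bd assms(1)
      by (subst fps_nth_geo2 [OF assms(1) b]) auto
  qed
qed

text \<open>F is a polynomial of degree at most p, symmetric under reversal. The degree p is
  explicit so that reversals can be combined with shifts.\<close>

definition reciprocal :: "nat \<Rightarrow> rat fps \<Rightarrow> bool" where
  "reciprocal p F \<longleftrightarrow> (\<forall>i. F $ i = (if i \<le> p then F $ (p - i) else 0))"

text \<open>Each factor \<open>1 - x\<^sup>n\<close> changes its sign when its coefficients are reversed, so a polynomial
  quotient of products with equally many such factors is palindromic.\<close>

lemma reciprocal_quotient: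
  assumes "fps_of_poly P * ((1 - fps_X ^ a) * (1 - fps_X ^ b)) = (1 - fps_X ^ c) * (1 - fps_X ^ d)"
    and "0 < a" "0 < b" "0 < c" "0 < d"
  shows "a + b \<le> c + d" "reciprocal (c + d - (a + b)) (fps_of_poly P)"
proof -
  define u :: "nat \<Rightarrow> rat poly" where "u n = 1 - monom 1 n" for n
  have ufps: "fps_of_poly (u n) = 1 - fps_X ^ n" for n
    by (simp add: u_def fps_of_poly_diff fps_of_poly_monom)
  have "fps_of_poly (P * (u a * u b)) = fps_of_poly (u c * u d)"
    using assms(1) by (simp add: fps_of_poly_mult ufps)
  then have eq: "P * (u a * u b) = u c * u d" by (simp only: fps_of_poly_eq_iff)
  have deg: "degree (u n) = n" and u0: "u n \<noteq> 0" and refl: "reflect_poly (u n) = - u n"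
    if "0 < n" for n
  proof -
    have c: "coeff (u n) i = (if i = 0 then 1 else if i = n then -1 else 0)" for i
      using that by (auto simp: u_def coeff_1)
    show deg: "degree (u n) = n"
      using that by (intro antisym degree_le le_degree) (auto simp: c)
    show "u n \<noteq> 0" using deg that by auto
    show "reflect_poly (u n) = - u n"
      using that by (intro poly_eqI) (auto simp: coeff_reflect_poly deg c)
  qed
  have P0: "P \<noteq> 0" using eq u0 assms by auto
  have "degree P + (a + b) = c + d"
    using arg_cong [OF eq, of degree] P0 u0 assms deg by (simp add: degree_mult_eq)
  then show "a + b \<le> c + d" by simp
  have dP: "degree P = c + d - (a + b)" using \<open>degree P + (a + b) = c + d\<close> by simp
  have "reflect_poly P * (u a * u b) = u c * u d"
    using arg_cong [OF eq, of reflect_poly] assms by (simp add: reflect_poly_mult refl)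
  then have "reflect_poly P = P" using eq u0 assms by (metis mult_right_cancel no_zero_divisors)
  then have "coeff P i = (if degree P < i then 0 else coeff P (degree P - i))" for i
    by (metis coeff_reflect_poly)
  then show "reciprocal (c + d - (a + b)) (fps_of_poly P)"
    unfolding reciprocal_def dP [symmetric] by (metis fps_of_poly_nth not_less)
qed

text \<open>Reversal of the window from 0 to D keeps a palindromic block of width p and exchanges
  the gap s below it with the gap r above it.\<close>

lemma reciprocal_shift:
  assumes "reciprocal p F" "s + p + r = D"
  shows "e \<le> D \<Longrightarrow> (fps_X ^ s * F) $ (D - e) = (fps_X ^ r * F) $ e"
    and "D < d \<Longrightarrow> (fps_X ^ s * F) $ d = 0"
proof -
  have F: "F $ i = (if i \<le> p then F $ (p - i) else 0)" for i using assms(1) by (simp add: reciprocal_def)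
  show "(fps_X ^ s * F) $ (D - e) = (fps_X ^ r * F) $ e" if "e \<le> D"
  proof (cases "r \<le> e \<and> e - r \<le> p")
    case True
    then have "D - e - s = p - (e - r)" "\<not> D - e < s" using assms(2) that by auto
    then show ?thesis using True F [of "e - r"] by (simp add: fps_X_power_mult_nth)
  next
    case False
    then have "F $ (e - r) = 0 \<or> e < r" using F [of "e - r"] by auto
    moreover have "D - e < s \<or> p < D - e - s" using False assms(2) that by auto
    then have "D - e < s \<or> F $ (D - e - s) = 0" using F [of "D - e - s"] by auto
    ultimately show ?thesis by (auto simp: fps_X_power_mult_nth)
  qed
  show "(fps_X ^ s * F) $ d = 0" if "D < d"
    using that assms(2) F [of "d - s"] by (auto simp: fps_X_power_mult_nth)
qed

lemma one_minus_X_power_dvd: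
  assumes "a dvd b" shows "(1 - monom 1 a :: rat poly) dvd 1 - monom 1 b"
proof -
  obtain k where k: "b = a * k" using assms by blast
  have "1 - (monom 1 a :: rat poly) ^ k = (1 - monom 1 a) * (\<Sum>i<k. monom 1 a ^ i)"
    by (rule one_diff_power_eq)
  then show ?thesis by (simp add: monom_power k)
qed

text \<open>By the linear relation c is a greatest common divisor of a and b, so a b divides c times
  any common multiple x; y supplies the factor c.\<close>

lemma bezout_dvd:
  fixes a b c :: "'a::idom"
  assumes "a dvd x" "b dvd x" "c dvd a" "c dvd b" "c dvd y" "a - u * b = c"
  shows "a * b dvd y * x"
proof (cases "c = 0")
  case True then show ?thesis using assms by auto
next
  case False
  obtain a' b' y' where *: "a = c * a'" "b = c * b'" "y = c * y'" using assms by (elim dvdE) blast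
  obtain s t where x: "x = a * s" "x = b * t" using assms by (elim dvdE) blast
  have "c * (a' - u * b') = c * 1" using assms(6) * by (simp add: algebra_simps)
  then have one: "a' - u * b' = 1" using False by (metis mult_left_cancel)
  have "x = x * a' - u * (x * b')" using one by (metis mult.right_neutral right_diff_distrib mult.left_commute)
  also have "x * a' = c * a' * b' * t" using x(2) * by (simp add: mult_ac)
  also have "x * b' = c * a' * b' * s" using x(1) * by (simp add: mult_ac)
  finally have "x = c * a' * b' * (t - u * s)" by (simp add: algebra_simps)
  then have "y * x = a * b * (y' * (t - u * s))" using * by (simp add: mult_ac)
  then show ?thesis by simp
qed

lemma dvd_power_minus_one: "k dvd m \<Longrightarrow> q ^ k - 1 dvd q ^ m - (1::nat)"
proof -
  assume "k dvd m" then obtain j where j: "m = k * j" by blast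
  have "x - 1 dvd x ^ j - 1" for x :: nat
  proof (induction j)
    case (Suc j)
    have "x ^ Suc j - 1 = x * (x ^ j - 1) + (x - 1)" if "0 < x"
      using that by (simp add: algebra_simps)
    with Suc show ?case by (cases "x = 0") (simp, simp only: dvd_add dvd_mult dvd_refl)
  qed simp
  from this [of "q ^ k"] show ?thesis by (simp only: j power_mult)
qed

text \<open>The quotient is a (q,t)-binomial coefficient. For even m each denominator factor divides
  its own numerator factor; for odd m, q^2 - 1 need not divide q^m - 1.\<close>

lemma quotient_poly:
  assumes "2 \<le> q" "2 \<le> m"
  shows "\<exists>P. fps_of_poly P * ((1 - fps_X ^ (q\<^sup>2 - 1)) * (1 - fps_X ^ (q\<^sup>2 - q)))
    = ((1 - fps_X ^ (q ^ m - 1)) * (1 - fps_X ^ (q ^ m - q)) :: rat fps)"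
proof -
  define u :: "nat \<Rightarrow> rat poly" where "u n = 1 - monom 1 n" for n
  have ufps: "fps_of_poly (u n) = 1 - fps_X ^ n" for n
    by (simp add: u_def fps_of_poly_diff fps_of_poly_monom)
  obtain k where k: "m = Suc k" "1 \<le> k" using assms by (cases m) auto
  have e1: "q\<^sup>2 - q = q * (q - 1)" "q ^ m - q = q * (q ^ k - 1)"
    using k by (auto simp: power2_eq_square algebra_simps)
  have d1: "q\<^sup>2 - q dvd q ^ m - q"
    using dvd_power_minus_one [of 1 k q] unfolding e1 by (intro mult_dvd_mono) auto
  have "u (q\<^sup>2 - 1) * u (q\<^sup>2 - q) dvd u (q ^ m - 1) * u (q ^ m - q)"
  proof (cases "even m")
    case True
    then show ?thesis unfolding u_def
      by (intro mult_dvd_mono one_minus_X_power_dvd d1 dvd_power_minus_one)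
  next
    case False
    \<comment> \<open>Here both factors of the denominator divide \<open>1 - x^(q^m - q)\<close>, and their greatest common divisor
      \<open>1 - x^(q - 1)\<close> divides \<open>1 - x^(q^m - 1)\<close>.\<close>
    then have "even k" using k by simp
    then have "q\<^sup>2 - 1 dvd q ^ k - 1" by (intro dvd_power_minus_one)
    then have d2: "q\<^sup>2 - 1 dvd q ^ m - q" unfolding e1 by simp
    have d3: "q - 1 dvd q ^ j - 1" for j using dvd_power_minus_one [of 1 j q] by simp
    have s: "(q - 1) + q * (q - 1) = q\<^sup>2 - 1" using assms by (simp add: power2_eq_square algebra_simps)
    show ?thesis
      \<comment> \<open>The relation is (1 - t^(q^2-1)) - t^(q-1) (1 - t^(q^2-q)) = 1 -
        t^(q-1).\<close>
      apply (rule bezout_dvd [of _ _ _ "u (q - 1)" _ "monom 1 (q - 1)"])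
      unfolding u_def
      using d1 d2 d3 [of m] d3 [of 2] e1
      by (auto intro!: one_minus_X_power_dvd simp: right_diff_distrib mult_monom s [simplified])
  qed
  then obtain P where "u (q ^ m - 1) * u (q ^ m - q) = u (q\<^sup>2 - 1) * u (q\<^sup>2 - q) * P" by blast
  then have "fps_of_poly (P * (u (q\<^sup>2 - 1) * u (q\<^sup>2 - q))) = fps_of_poly (u (q ^ m - 1) * u (q ^ m - q))"
    by (simp add: mult_ac)
  then show ?thesis unfolding fps_of_poly_mult ufps by blast
qed


section \<open>Explicit series for the two compositions\<close>

lemma weak_subcompositions_2: "weak_subcompositions [2] = {[0], [1], [2]}"
proof -
  have "\<beta> \<in> {[0], [1], [2]}" if "\<beta> \<in> weak_subcompositions [2]" for \<beta>
  proof -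
    have "length \<beta> = Suc 0" using that by (simp add: weak_subcompositions_def)
    then obtain x where "\<beta> = [x]" by (auto simp: length_Suc_conv)
    moreover have "x \<le> 2" using that \<open>\<beta> = [x]\<close> by (auto simp: weak_subcompositions_def)
    ultimately show ?thesis by auto
  qed
  then show ?thesis by (auto simp: weak_subcompositions_def)
qed

lemma weak_subcompositions_1_1: "weak_subcompositions [1, 1] = {[0, 0], [1, 0], [0, 1], [1, 1]}"
proof -
  have "\<beta> \<in> {[0, 0], [1, 0], [0, 1], [1, 1]}" if "\<beta> \<in> weak_subcompositions [1, 1]" for \<beta>
  proof -
    have "length \<beta> = Suc (Suc 0)" using that by (simp add: weak_subcompositions_def)
    then obtain x y where \<beta>: "\<beta> = [x, y]" by (auto simp: length_Suc_conv)
    have "\<beta> ! 0 \<le> 1" "\<beta> ! 1 \<le> 1" using that by (auto simp: weak_subcompositions_def less_Suc_eq)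
    then show ?thesis by (auto simp: \<beta> le_Suc_eq)
  qed
  then show ?thesis by (auto simp: weak_subcompositions_def less_Suc_eq)
qed

text \<open>With the bound on |beta| moved into the summand, the index set no longer depends on m
  and can be enumerated.\<close>

lemma C_series_altdef:
  "finite (weak_subcompositions \<alpha>) \<Longrightarrow> C_series q \<alpha> m =
    (\<Sum>\<beta>\<in>weak_subcompositions \<alpha>. if sum_list \<beta> \<le> m then
       fps_X ^ (\<Sum>i<length \<alpha>. (\<alpha> ! i - \<beta> ! i) * (q ^ m - q ^ partial_sum \<beta> (Suc i))) *
       ((\<Prod>j<sum_list \<beta>. 1 - fps_X ^ (q ^ m - q ^ j)) /
        (\<Prod>i<length \<alpha>. \<Prod>j<\<beta> ! i.
           1 - fps_X ^ (q ^ partial_sum \<beta> (Suc i) - q ^ (partial_sum \<beta> i + j)))) else 0)"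
  unfolding C_series_def by (subst sum.inter_filter [symmetric]) simp_all

lemma fps_divide_geo: "0 < a \<Longrightarrow> F / (1 - fps_X ^ a) = F * geo a"
  using fps_divide_unit [OF one_minus_X_power_nth_0, of a F] fps_divide_unit [OF one_minus_X_power_nth_0, of a 1]
  by (simp only: mult_1_left)

lemma fps_divide_geo2:
  assumes "0 < a" "0 < b"
  shows "F / ((1 - fps_X ^ a) * (1 - fps_X ^ b)) = F * geo2 a b"
proof -
  have "((1 - fps_X ^ a) * (1 - fps_X ^ b) :: rat fps) $ 0 \<noteq> 0"
    by (simp only: fps_mult_nth_0 mult_eq_0_iff one_minus_X_power_nth_0 assms simp_thms)
  from fps_divide_unit [OF this, of F] fps_divide_unit [OF this, of 1] show ?thesis
    by (simp only: geo2_def mult_1_left)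
qed

definition geo_part :: "nat \<Rightarrow> nat \<Rightarrow> rat fps" where
  "geo_part q Q = (1 - fps_X ^ (Q - 1)) * geo (q - 1)"

definition geo2_part :: "nat \<Rightarrow> nat \<Rightarrow> nat \<Rightarrow> rat fps" where
  "geo2_part a q Q = (1 - fps_X ^ (Q - 1)) * ((1 - fps_X ^ (Q - q)) * geo2 a (q\<^sup>2 - q))"

context
  fixes q :: nat
  assumes q: "2 \<le> q"
begin

lemma exponents_pos: "0 < q - 1" "0 < q\<^sup>2 - q" "0 < q\<^sup>2 - 1" "q \<le> q\<^sup>2 - q"
proof -
  have "2 * q \<le> q\<^sup>2" using q by (simp add: power2_eq_square)
  then show "0 < q - 1" "0 < q\<^sup>2 - q" "0 < q\<^sup>2 - 1" "q \<le> q\<^sup>2 - q" using q by linarith+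
qed

lemma C_series_2:
  "C_series q [2] m = fps_X ^ (2 * (q ^ m - 1)) +
    (if 1 \<le> m then fps_X ^ (q ^ m - q) * geo_part q (q ^ m) else 0) +
    (if 2 \<le> m then geo2_part (q\<^sup>2 - 1) q (q ^ m) else 0)"
proof -
  have eq: "C_series q [2] m = fps_X ^ (2 * (q ^ m - 1)) +
    (if 1 \<le> m then fps_X ^ (q ^ m - q) * ((1 - fps_X ^ (q ^ m - 1)) / (1 - fps_X ^ (q - 1))) else 0) +
    (if 2 \<le> m then (1 - fps_X ^ (q ^ m - 1)) * (1 - fps_X ^ (q ^ m - q)) /
      ((1 - fps_X ^ (q\<^sup>2 - 1)) * (1 - fps_X ^ (q\<^sup>2 - q))) else 0)"
    apply (subst C_series_altdef)
     apply (simp add: weak_subcompositions_2)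
    unfolding weak_subcompositions_2
    by (simp add: partial_sum_def numeral_2_eq_2)
  show ?thesis
    unfolding eq geo_part_def geo2_part_def
    using exponents_pos by (simp only: fps_divide_geo [where F = "1 - fps_X ^ (q ^ m - 1)"] fps_divide_geo2 mult.assoc)
qed

text \<open>The summands belong to beta = (0,0), (1,0), (0,1) and (1,1) in this order. The middle
  two differ only in the shift, because B_1 is 1 for (1,0) and 0 for (0,1).\<close>

lemma C_series_1_1:
  "C_series q [1, 1] m = fps_X ^ (2 * (q ^ m - 1)) +
    (if 1 \<le> m then fps_X ^ (q ^ m - q) * geo_part q (q ^ m) + fps_X ^ (q ^ m - 1) * geo_part q (q ^ m) else 0) +
    (if 2 \<le> m then geo2_part (q - 1) q (q ^ m) else 0)"
proof -
  have eq: "C_series q [1, 1] m = fps_X ^ (2 * (q ^ m - 1)) +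
    (if 1 \<le> m then fps_X ^ (q ^ m - q) * ((1 - fps_X ^ (q ^ m - 1)) / (1 - fps_X ^ (q - 1)))
      + fps_X ^ (q ^ m - 1) * ((1 - fps_X ^ (q ^ m - 1)) / (1 - fps_X ^ (q - 1))) else 0) +
    (if 2 \<le> m then (1 - fps_X ^ (q ^ m - 1)) * (1 - fps_X ^ (q ^ m - q)) /
      ((1 - fps_X ^ (q - 1)) * (1 - fps_X ^ (q\<^sup>2 - q))) else 0)"
    apply (subst C_series_altdef)
     apply (simp add: weak_subcompositions_1_1 [simplified])
    unfolding weak_subcompositions_1_1
    by (simp add: partial_sum_def numeral_2_eq_2)
  show ?thesis
    unfolding eq geo_part_def geo2_part_def
    using exponents_pos by (simp only: fps_divide_geo [where F = "1 - fps_X ^ (q ^ m - 1)"] fps_divide_geo2 mult.assoc)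
qed

lemma cofixed_series_2:
  "cofixed_series q [2] = 1 + fps_X ^ (2 * (q - 1)) * geo (q - 1) +
    fps_X ^ (2 * (q\<^sup>2 - 1)) * geo2 (q\<^sup>2 - 1) (q\<^sup>2 - q)"
proof -
  have "cofixed_series q [2] = 1 + fps_X ^ (2 * (q - 1)) * geo (q - 1) +
    fps_X ^ (2 * (q\<^sup>2 - 1)) * (geo (q\<^sup>2 - 1) * geo (q\<^sup>2 - q))"
    unfolding cofixed_series_def weak_subcompositions_2 by (simp add: partial_sum_def numeral_2_eq_2)
  then show ?thesis using exponents_pos by (simp only: geo2_altdef)
qed

lemma cofixed_series_1_1:
  "cofixed_series q [1, 1] = 1 + fps_X ^ (2 * (q - 1)) * geo (q - 1) + fps_X ^ (q - 1) * geo (q - 1) +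
    fps_X ^ ((q - 1) + (q\<^sup>2 - 1)) * geo2 (q - 1) (q\<^sup>2 - q)"
proof -
  have "cofixed_series q [1, 1] = 1 + fps_X ^ (2 * (q - 1)) * geo (q - 1) + fps_X ^ (q - 1) * geo (q - 1) +
    fps_X ^ ((q - 1) + (q\<^sup>2 - 1)) * (geo (q - 1) * geo (q\<^sup>2 - q))"
    unfolding cofixed_series_def weak_subcompositions_1_1 by (simp add: partial_sum_def numeral_2_eq_2)
  then show ?thesis using exponents_pos by (simp only: geo2_altdef)
qed

lemma fps_nth_X_power_mult_truncated:
  assumes "e < r + n"
  shows "(fps_X ^ r * ((1 - fps_X ^ n) * (F :: rat fps))) $ e = (fps_X ^ r * F) $ e"
  using assms by (auto simp: fps_X_power_mult_nth fps_nth_one_minus_X_power_mult)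

lemma square_le_power:
  assumes "2 \<le> m"
  shows "q\<^sup>2 \<le> q ^ m"
  using assms q by (intro power_increasing) auto

lemma reciprocal_geo_part:
  assumes "1 \<le> m"
  shows "reciprocal (q ^ m - q) (geo_part q (q ^ m))"
proof -
  let ?Q = "q ^ m"
  have Qq: "q \<le> ?Q" using assms q power_increasing [of 1 m q] by simp
  have "1 - monom 1 (q - 1) dvd (1 - monom 1 (?Q - 1) :: rat poly)"
    using dvd_power_minus_one [of 1 m q] by (intro one_minus_X_power_dvd) simp
  then obtain P :: "rat poly" where "1 - monom 1 (?Q - 1) = (1 - monom 1 (q - 1)) * P" by (elim dvdE)
  from arg_cong [OF this, of fps_of_poly]
  have P: "1 - fps_X ^ (?Q - 1) = (1 - fps_X ^ (q - 1)) * fps_of_poly P"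
    by (simp add: fps_of_poly_mult fps_of_poly_diff fps_of_poly_monom)
  have "geo_part q ?Q = ((1 - fps_X ^ (q - 1)) * geo (q - 1)) * fps_of_poly P"
    by (simp only: geo_part_def P mult_ac)
  then have part: "geo_part q ?Q = fps_of_poly P" by (simp only: geo_mult exponents_pos mult_1_left)
  \<comment> \<open>A dummy factor 1 - t on both sides fits the quotient into the criterion for two
    factors; it cancels in the degree Q - q.\<close>
  have "fps_of_poly P * ((1 - fps_X ^ (q - 1)) * (1 - fps_X ^ 1)) = (1 - fps_X ^ (?Q - 1)) * (1 - fps_X ^ 1)"
    by (simp only: P mult_ac)
  from reciprocal_quotient(2) [OF this] exponents_pos Qq q show ?thesis
    by (simp add: part)
qed

lemma geo2_part_poly:
  assumes "fps_of_poly P * ((1 - fps_X ^ a) * (1 - fps_X ^ (q\<^sup>2 - q)))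
    = (1 - fps_X ^ (Q - 1)) * (1 - fps_X ^ (Q - q))" and "0 < a"
  shows "geo2_part a q Q = fps_of_poly P"
proof -
  have "geo2_part a q Q = (1 - fps_X ^ (Q - 1)) * (1 - fps_X ^ (Q - q)) * geo2 a (q\<^sup>2 - q)"
    by (simp only: geo2_part_def mult.assoc)
  also have "\<dots> = fps_of_poly P * ((1 - fps_X ^ a) * (1 - fps_X ^ (q\<^sup>2 - q)) * geo2 a (q\<^sup>2 - q))"
    by (simp only: assms(1) [symmetric] mult.assoc)
  also have "\<dots> = fps_of_poly P" by (simp only: geo2_mult exponents_pos assms(2) mult_1_right)
  finally show ?thesis .
qed

lemma reciprocal_geo2_part:
  assumes "2 \<le> m" and a: "a = q - 1 \<or> a = q\<^sup>2 - 1"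
  shows "a + (q\<^sup>2 - q) \<le> (q ^ m - 1) + (q ^ m - q)"
    and "reciprocal ((q ^ m - 1) + (q ^ m - q) - (a + (q\<^sup>2 - q))) (geo2_part a q (q ^ m))"
proof -
  let ?Q = "q ^ m"
  have "\<exists>P. fps_of_poly P * ((1 - fps_X ^ a) * (1 - fps_X ^ (q\<^sup>2 - q)))
      = ((1 - fps_X ^ (?Q - 1)) * (1 - fps_X ^ (?Q - q)) :: rat fps)"
  proof (cases "a = q\<^sup>2 - 1")
    case True
    then show ?thesis using quotient_poly [OF q assms(1)] by simp
  next
    case False
    then have a: "a = q - 1" using a by simp
    obtain k where k: "m = Suc k" using assms(1) by (cases m) auto
    have "q\<^sup>2 - q = q * (q - 1)" "?Q - q = q * (q ^ k - 1)"
      using k by (auto simp: power2_eq_square algebra_simps)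
    then have "q\<^sup>2 - q dvd ?Q - q"
      using dvd_power_minus_one [of 1 k q] by (simp add: mult_dvd_mono)
    then have "(1 - monom 1 a) * (1 - monom 1 (q\<^sup>2 - q))
        dvd (1 - monom 1 (?Q - 1)) * (1 - monom 1 (?Q - q) :: rat poly)"
      using dvd_power_minus_one [of 1 m q] by (intro mult_dvd_mono one_minus_X_power_dvd) (simp_all add: a)
    then obtain P :: "rat poly" where
      "(1 - monom 1 (?Q - 1)) * (1 - monom 1 (?Q - q)) = (1 - monom 1 a) * (1 - monom 1 (q\<^sup>2 - q)) * P"
      by (elim dvdE)
    from arg_cong [OF this, of fps_of_poly] show ?thesis
      by (intro exI [of _ P]) (simp add: fps_of_poly_mult fps_of_poly_diff fps_of_poly_monom mult_ac)
  qed
  then obtain P where P: "fps_of_poly P * ((1 - fps_X ^ a) * (1 - fps_X ^ (q\<^sup>2 - q)))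
      = ((1 - fps_X ^ (?Q - 1)) * (1 - fps_X ^ (?Q - q)) :: rat fps)" by blast
  have "0 < a" using a exponents_pos by auto
  have "q < q\<^sup>2" using exponents_pos by simp
  then have Q: "0 < ?Q - 1" "0 < ?Q - q" using square_le_power [OF assms(1)] q by linarith+
  note r = reciprocal_quotient [OF P \<open>0 < a\<close> exponents_pos(2) Q]
  show "a + (q\<^sup>2 - q) \<le> (q ^ m - 1) + (q ^ m - q)" by (rule r(1))
  show "reciprocal ((q ^ m - 1) + (q ^ m - q) - (a + (q\<^sup>2 - q))) (geo2_part a q (q ^ m))"
    using r(2) by (simp only: geo2_part_poly [OF P \<open>0 < a\<close>])
qed

lemma fps_nth_X_power: "(fps_X ^ n :: rat fps) $ d = (if d = n then 1 else 0)"
  by (simp add: fps_X_power_nth)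

lemma C_series_high:
  assumes "2 * (q ^ m - 1) < d"
  shows "C_series q [2] m $ d = 0" "C_series q [1, 1] m $ d = 0"
proof -
  let ?Q = "q ^ m"
  have 1: "(fps_X ^ s * geo_part q ?Q) $ d = 0" if "1 \<le> m" "s = ?Q - q \<or> s = ?Q - 1" for s
  proof (rule reciprocal_shift(2) [OF reciprocal_geo_part [OF that(1)] _ assms])
    have "q \<le> ?Q" using that(1) q power_increasing [of 1 m q] by simp
    then show "s + (?Q - q) + (2 * (?Q - 1) - s - (?Q - q)) = 2 * (?Q - 1)" using that(2) q by auto
  qed
  have 2: "geo2_part a q ?Q $ d = 0" if "2 \<le> m" "a = q - 1 \<or> a = q\<^sup>2 - 1" for a
  proof -
    let ?p = "(?Q - 1) + (?Q - q) - (a + (q\<^sup>2 - q))"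
    have "(fps_X ^ 0 * geo2_part a q ?Q) $ d = 0"
      using q by (intro reciprocal_shift(2) [OF reciprocal_geo2_part(2) [OF that] _ assms, of _ "2 * (?Q - 1) - ?p"]) auto
    then show ?thesis by simp
  qed
  show "C_series q [2] m $ d = 0" "C_series q [1, 1] m $ d = 0"
    using assms 1 2 by (simp_all only: C_series_2 C_series_1_1 fps_add_nth fps_nth_X_power fps_zero_nth)
      (auto simp: 1 2)
qed

text \<open>Reversal turns the shift s of each summand into r = D - s - p, which is the exponent in
  the matching cofixed summand. Below degree Q the numerator factors have no effect after the shift
  by r, so only the geometric series remain.\<close>

lemma C_series_reversed:
  assumes "e < q ^ m"
  shows "C_series q [2] m $ (2 * (q ^ m - 1) - e) = cofixed_series q [2] $ e"
    "C_series q [1, 1] m $ (2 * (q ^ m - 1) - e) = cofixed_series q [1, 1] $ e"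
proof -
  let ?Q = "q ^ m"
  let ?D = "2 * (?Q - 1)"
  have eD: "e \<le> ?D" using assms by linarith
  have 0: "(fps_X ^ ?D :: rat fps) $ (?D - e) = 1 $ e"
    using eD by (auto simp: fps_nth_X_power)
  have 1: "(if 1 \<le> m then (fps_X ^ s * geo_part q ?Q) $ (?D - e) else 0) = (fps_X ^ r * geo (q - 1)) $ e"
    if sr: "s = ?Q - q \<and> r = 2 * (q - 1) \<or> s = ?Q - 1 \<and> r = q - 1" for s r
  proof (cases "1 \<le> m")
    case True
    have "q \<le> ?Q" using True q power_increasing [of 1 m q] by simp
    then have "s + (?Q - q) + r = ?D" using sr q by auto
    from reciprocal_shift(1) [OF reciprocal_geo_part [OF True] this eD]
    have "(fps_X ^ s * geo_part q ?Q) $ (?D - e) = (fps_X ^ r * geo_part q ?Q) $ e" .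
    also have "\<dots> = (fps_X ^ r * geo (q - 1)) $ e"
      unfolding geo_part_def using assms sr q by (intro fps_nth_X_power_mult_truncated) auto
    finally show ?thesis using True by simp
  next
    case False
    then have "m = 0" by simp
    \<comment> \<open>For m = 0 the summand is absent from C, but e = 0 and the cofixed summand
      starts only in degree r > 0.\<close>
    then have "e < r" using assms sr q by auto
    then show ?thesis using False by (simp add: fps_X_power_mult_nth)
  qed
  have 2: "(if 2 \<le> m then geo2_part a q ?Q $ (?D - e) else 0) = (fps_X ^ r * geo2 a (q\<^sup>2 - q)) $ e"
    if ar: "a = q - 1 \<and> r = (q - 1) + (q\<^sup>2 - 1) \<or> a = q\<^sup>2 - 1 \<and> r = 2 * (q\<^sup>2 - 1)" for a r
  proof (cases "2 \<le> m")
    case True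
    have a: "a = q - 1 \<or> a = q\<^sup>2 - 1" using ar by blast
    let ?p = "(?Q - 1) + (?Q - q) - (a + (q\<^sup>2 - q))"
    have "q < q\<^sup>2" "q\<^sup>2 \<le> ?Q" using exponents_pos square_le_power [OF True] by auto
    then have "0 + ?p + r = ?D" "q \<le> r" using ar reciprocal_geo2_part(1) [OF True a] q by auto
    from reciprocal_shift(1) [OF reciprocal_geo2_part(2) [OF True a] this(1) eD]
    have "geo2_part a q ?Q $ (?D - e) = (fps_X ^ r * geo2_part a q ?Q) $ e" by simp
    also have "\<dots> = (fps_X ^ r * ((1 - fps_X ^ (?Q - q)) * geo2 a (q\<^sup>2 - q))) $ e"
      unfolding geo2_part_def using assms \<open>q \<le> r\<close> q by (intro fps_nth_X_power_mult_truncated) auto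
    also have "\<dots> = (fps_X ^ r * geo2 a (q\<^sup>2 - q)) $ e"
      using assms \<open>q \<le> r\<close> by (intro fps_nth_X_power_mult_truncated) auto
    finally show ?thesis using True by simp
  next
    case False
    \<comment> \<open>Again an absent summand of C faces a cofixed summand that starts in a degree r
      \<ge> q \<ge> Q > e.\<close>
    then have "m = 0 \<or> m = 1" by auto
    then have "?Q \<le> q" using q by auto
    moreover have "q \<le> r" using ar exponents_pos q by auto
    ultimately have "e < r" using assms by simp
    then show ?thesis using False by (simp add: fps_X_power_mult_nth)
  qed
  \<comment> \<open>Reflexivity settles the side conditions on shifts, which leaves one rewrite rule
    for each kind of summand.\<close>
  note terms = 1 [OF disjI1 [OF conjI [OF refl refl]]] 1 [OF disjI2 [OF conjI [OF refl refl]]]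
    2 [OF disjI1 [OF conjI [OF refl refl]]] 2 [OF disjI2 [OF conjI [OF refl refl]]]
  have if_nth: "(if P then F else 0) $ n = (if P then F $ n else (0 :: rat))" for P F n by simp
  have if_add: "(if P then x + y else 0) = (if P then x else 0) + (if P then y else (0 :: rat))" for P x y
    by simp
  show "C_series q [2] m $ (?D - e) = cofixed_series q [2] $ e"
    by (simp only: C_series_2 cofixed_series_2 fps_add_nth if_nth 0 terms)
  show "C_series q [1, 1] m $ (?D - e) = cofixed_series q [1, 1] $ e"
    by (simp only: C_series_1_1 cofixed_series_1_1 fps_add_nth if_nth if_add 0 terms add.assoc)
qed

text \<open>Below Q - q only the summand with |beta| = 2 contributes, and its numerator is still
  invisible. The last q degrees depend on a cancellation between summands.\<close>

lemma C_series_low: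
  assumes "d < q ^ m"
  shows "C_series q [2] m $ d = geo2 (q\<^sup>2 - 1) (q\<^sup>2 - q) $ d"
    "C_series q [1, 1] m $ d = geo2 (q - 1) (q\<^sup>2 - q) $ d"
proof -
  let ?Q = "q ^ m"
  let ?D = "2 * (?Q - 1)"
  have dvd_less_q: "q - 1 dvd k \<longleftrightarrow> k = 0 \<or> k = q - 1" if "k < q" for k
    using that by (auto dest!: dvd_imp_le)
  have dvd_less_q2: "q\<^sup>2 - 1 dvd k \<longleftrightarrow> k = 0" if "k < q" for k
  proof -
    have "k < q\<^sup>2 - 1" using that exponents_pos q by simp
    then show ?thesis by (auto dest: nat_dvd_not_less)
  qed
  have H: "geo2 a (q\<^sup>2 - q) $ k = (if a dvd k then 1 else 0)" if "k < q" "0 < a" for k a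
    using that exponents_pos by (intro fps_nth_geo2_less) auto
  consider "m = 0" | "m = 1" | "2 \<le> m" by linarith
  then have "C_series q [2] m $ d = geo2 (q\<^sup>2 - 1) (q\<^sup>2 - q) $ d \<and>
    C_series q [1, 1] m $ d = geo2 (q - 1) (q\<^sup>2 - q) $ d"
  proof cases
    case 1
    then show ?thesis using assms exponents_pos unfolding C_series_2 C_series_1_1 by (simp add: H)
  next
    case 2
    have "geo_part q q = 1" unfolding geo_part_def by (rule geo_mult [OF exponents_pos(1)])
    then show ?thesis using 2 assms q exponents_pos dvd_less_q [of d] dvd_less_q2 [of d]
      unfolding C_series_2 C_series_1_1 by (auto simp: H fps_nth_X_power)
  next
    case 3
    have Q: "q\<^sup>2 \<le> ?Q" by (rule square_le_power [OF 3])
    moreover have "q < q\<^sup>2" using exponents_pos by simp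
    ultimately have qQ: "q < ?Q" by simp
    have g: "(fps_X ^ s * geo_part q ?Q) $ d = (if d < s then 0 else if q - 1 dvd d - s then 1 else 0)"
      if "?Q - q \<le> s" for s
    proof -
      have less: "d < s + (?Q - 1)" using assms that q qQ by auto
      show ?thesis
        unfolding geo_part_def fps_nth_X_power_mult_truncated [OF less]
        by (simp only: fps_X_power_mult_nth fps_nth_geo exponents_pos)
    qed
    have g2: "geo2_part a q ?Q $ d = geo2 a (q\<^sup>2 - q) $ d
        - (if d < ?Q - q then 0 else geo2 a (q\<^sup>2 - q) $ (d - (?Q - q))) - (if d < ?Q - 1 then 0 else 1)"
      if "0 < a" for a
    proof -
      have "geo2 a (q\<^sup>2 - q) $ 0 = 1" using H [of 0 a] that q by simp
      moreover have "d - (?Q - 1) = 0" using assms by simp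
      ultimately show ?thesis using qQ
        unfolding geo2_part_def fps_nth_one_minus_X_power_mult by simp
    qed
    have D: "d \<noteq> ?D" using assms q qQ by linarith
    show ?thesis
    proof (cases "d < ?Q - q")
      case True
      then have "d < ?Q - 1" using q by simp
      then show ?thesis using True 3 D exponents_pos
        unfolding C_series_2 C_series_1_1 by (simp add: g g2 fps_nth_X_power)
    next
      case False
      \<comment> \<open>At degree Q - q + k the numerator for |beta| = 2 removes [a divides k] +
        [k = q - 1]. The summands with |beta| = 1 restore [q - 1 divides k], and for the Borel group
        also [k = q - 1]. Since k < q, the condition q - 1 | k means k = 0 or k = q - 1, while q^2 -
        1 | k means k = 0, so the balance is 0 in both cases.\<close>
      define k where "k = d - (?Q - q)"
      have k: "k < q" "d = k + (?Q - q)" using False assms qQ by (auto simp: k_def)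
      have dk: "d < ?Q - 1 \<longleftrightarrow> k \<noteq> q - 1" using k qQ q by auto
      have dk': "d - (?Q - 1) = 0" using assms by simp
      have 10: "(fps_X ^ (?Q - q) * geo_part q ?Q) $ d = (if q - 1 dvd k then 1 else 0)"
        using g [OF order_refl] False unfolding k_def by simp
      have 01: "(fps_X ^ (?Q - 1) * geo_part q ?Q) $ d = (if k = q - 1 then 1 else 0)"
        using g [of "?Q - 1"] q unfolding dk dk' by simp
      have 11: "geo2_part a q ?Q $ d
          = geo2 a (q\<^sup>2 - q) $ d - (if a dvd k then 1 else 0) - (if k = q - 1 then 1 else 0)"
        if "0 < a" for a
        using g2 [OF that] H [OF k(1) that] False unfolding dk k_def [symmetric] by simp
      have m1: "1 \<le> m" using 3 by simp
      have X: "(fps_X ^ ?D :: rat fps) $ d = 0" using D by (simp add: fps_nth_X_power)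
      show ?thesis
        unfolding C_series_2 C_series_1_1 if_P [OF 3] if_P [OF m1] fps_add_nth
          X 10 01 11 [OF exponents_pos(1)] 11 [OF exponents_pos(3)] dvd_less_q [OF k(1)] dvd_less_q2 [OF k(1)]
        using exponents_pos(1) by auto
    qed
  qed
  then show "C_series q [2] m $ d = geo2 (q\<^sup>2 - 1) (q\<^sup>2 - q) $ d"
    "C_series q [1, 1] m $ d = geo2 (q - 1) (q\<^sup>2 - q) $ d" by blast+
qed

end


subsection \<open>The equivalence\<close>

text \<open>The count satisfies multiplicatively the recursion that the coefficients satisfy
  additively. In particular the rational coefficient is a natural number and serves as an exponent
  of q.\<close>

lemma card_eq_power_geo2:
  fixes c :: "nat \<Rightarrow> nat"
  assumes "\<And>d. c d = (if b dvd d then q else 1) * (if a \<le> d then c (d - a) else 1)"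
    and "0 < a" "0 < b"
  shows "\<exists>N. geo2 a b $ d = of_nat N \<and> c d = q ^ N"
proof (induction d rule: less_induct)
  case (less d)
  have rec: "geo2 a b $ d = (if d < a then 0 else geo2 a b $ (d - a)) + (if b dvd d then 1 else 0)"
    by (rule fps_nth_geo2 [OF assms(2,3)])
  show ?case
  proof (cases "d < a")
    case True
    then show ?thesis
      using rec assms(1) [of d] by (intro exI [of _ "if b dvd d then 1 else 0"]) auto
  next
    case False
    then obtain N where "geo2 a b $ (d - a) = of_nat N" "c (d - a) = q ^ N"
      using less.IH [of "d - a"] assms(2) by auto
    then show ?thesis
      using False rec assms(1) [of d] by (intro exI [of _ "N + (if b dvd d then 1 else 0)"]) auto
  qed
qed

lemma Hilb_nth: "Hilb U $ d = of_nat (vectorspace.dim class_ring (U d))"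
  by (simp add: Hilb_def)

lemma dim_fixed_quotient_low:
  fixes G :: "('k::{field,finite}^2^2) set"
  assumes G: "\<And>g. g \<in> G \<Longrightarrow> invertible g" and Q: "Q = CARD('k) ^ m" and "d < Q"
    and N: "card (invariants G d) = CARD('k) ^ N"
  shows "vectorspace.dim class_ring (fixed_quotient G (frobenius_power Q) d) = N"
proof -
  have "fixed_modulo G Q d \<inter> frobenius_power Q = {0}"
    using fixed_modulo_low_degree(2) [OF \<open>d < Q\<close>, where 'k = 'k]
      poly2.subspace_0 [OF subspace_fixed_modulo [where G = G and Q = Q and d = d]]
    unfolding fixed_modulo_def by blast
  then have "CARD('k) ^ vectorspace.dim class_ring (fixed_quotient G (frobenius_power Q) d) = CARD('k) ^ N"
    using card_fixed_quotient [where G = G, OF G Q, where d = d] N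
    by (simp add: fixed_modulo_low_degree(1) [OF \<open>d < Q\<close>])
  then show ?thesis using CARD_field_ge_2 [where 'k = 'k] by (simp add: power_inject_exp)
qed

text \<open>Two exponents with sum above 2 (Q - 1) cannot both be below Q, so the quotient itself
  vanishes in these degrees.\<close>

lemma dim_fixed_quotient_high:
  fixes G :: "('k::{field,finite}^2^2) set"
  assumes G: "\<And>g. g \<in> G \<Longrightarrow> invertible g" and Q: "Q = CARD('k) ^ m" and d: "2 * (Q - 1) < d"
  shows "vectorspace.dim class_ring (fixed_quotient G (frobenius_power Q) d) = 0"
proof -
  have "f \<in> frobenius_power Q" if "f \<in> fixed_modulo G Q d" for f
    unfolding frobenius_power_iff
  proof (intro allI impI)
    fix a b assume "lookup f (expo a b) \<noteq> 0"
    then have "a + b = d" using that by (simp add: fixed_modulo_def homogeneous_iff)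
    then show "Q \<le> a \<or> Q \<le> b" using d by auto
  qed
  then have "fixed_modulo G Q d \<inter> frobenius_power Q = fixed_modulo G Q d" by blast
  moreover have "card (fixed_modulo G Q d) \<noteq> 0"
    using finite_fixed_modulo [where G = G and Q = Q and d = d]
      poly2.subspace_0 [OF subspace_fixed_modulo [where G = G and Q = Q and d = d]] by auto
  ultimately have "CARD('k) ^ vectorspace.dim class_ring (fixed_quotient G (frobenius_power Q) d) = CARD('k) ^ 0"
    using card_fixed_quotient [where G = G, OF G Q, where d = d] by simp
  then show ?thesis using CARD_field_ge_2 [where 'k = 'k] by (simp add: power_inject_exp)
qed

text \<open>The argument common to both groups. H is the Hilbert series of the true invariants; it
  and the coefficients of C are known without assuming either side of the equivalence.\<close>

lemma Hilb_fixed_iff_Hilb_cofixed: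
  fixes G :: "('k::{field,finite}^2^2) set" and C :: "nat \<Rightarrow> rat fps"
  assumes G: "\<And>g. g \<in> G \<Longrightarrow> invertible g" and q: "q = CARD('k)"
    and inv: "\<And>d. \<exists>N. H $ d = of_nat N \<and> card (invariants G d) = q ^ N"
    and low: "\<And>m d. d < q ^ m \<Longrightarrow> C m $ d = H $ d"
    and rev: "\<And>m e. e < q ^ m \<Longrightarrow> C m $ (2 * (q ^ m - 1) - e) = D $ e"
    and high: "\<And>m d. 2 * (q ^ m - 1) < d \<Longrightarrow> C m $ d = 0"
  shows "(\<forall>m. Hilb (fixed_quotient G (frobenius_power (q ^ m))) = C m) \<longleftrightarrow> Hilb (cofixed G) = D"
proof
  have dual: "Hilb (fixed_quotient G (frobenius_power (q ^ m))) $ (2 * (q ^ m - 1) - e) = Hilb (cofixed G) $ e"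
    if "e < q ^ m" for m e
    unfolding Hilb_nth using dim_fixed_quotient_eq_dim_cofixed [OF G] that by (simp add: q)
  {
    assume fixed: "\<forall>m. Hilb (fixed_quotient G (frobenius_power (q ^ m))) = C m"
    show "Hilb (cofixed G) = D"
    proof (rule fps_ext)
      fix e
      \<comment> \<open>Any m with e < q^m would do; m = e is a uniform choice because q \<ge>
        2.\<close>
      have "e < 2 ^ e" by (rule less_exp)
      also have "\<dots> \<le> q ^ e" using CARD_field_ge_2 [where 'k = 'k] by (simp add: q power_mono)
      finally show "Hilb (cofixed G) $ e = D $ e" using dual [of e e] rev [of e e] fixed by simp
    qed
  next
    assume cofixed: "Hilb (cofixed G) = D"
    show "\<forall>m. Hilb (fixed_quotient G (frobenius_power (q ^ m))) = C m"
    proof (intro allI fps_ext)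
      fix m d
      let ?Q = "q ^ m"
      consider "d < ?Q" | "?Q \<le> d" "d \<le> 2 * (?Q - 1)" | "2 * (?Q - 1) < d" by linarith
      then show "Hilb (fixed_quotient G (frobenius_power ?Q)) $ d = C m $ d"
      proof cases
        case 1
        obtain N where N: "H $ d = of_nat N" "card (invariants G d) = CARD('k) ^ N"
          using inv q by blast
        then show ?thesis
          using dim_fixed_quotient_low [OF G _ 1 N(2)] low [OF 1] q by (simp add: Hilb_nth)
      next
        case 2
        define e where "e = 2 * (?Q - 1) - d"
        have "0 < ?Q" by (simp add: q)
        \<comment> \<open>From d \<ge> Q follows e \<le> Q - 2, so duality covers all the middle
          degrees.\<close>
        have e: "e < ?Q" "d = 2 * (?Q - 1) - e" using 2 \<open>0 < ?Q\<close> unfolding e_def by linarith+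
        then show ?thesis using dual [OF e(1)] rev [OF e(1)] cofixed by simp
      next
        case 3
        then show ?thesis
          using dim_fixed_quotient_high [OF G _ 3 [unfolded q]] high [OF 3] by (simp add: Hilb_nth q)
      qed
    qed
  }
qed

unbundle no fps_syntax
unbundle vec_syntax

theorem corollary3p6:
  fixes q :: nat
  assumes "q = CARD('k::{field,finite})"
  shows
    "(\<forall>\<alpha>\<in>compositions 2. \<forall>m.
        Hilb (fixed_quotient (parabolic \<alpha> :: ('k^2^2) set) (frobenius_power (q ^ m))) = C_series q \<alpha> m)
     \<longleftrightarrow>
     (\<forall>\<alpha>\<in>compositions 2.
        Hilb (cofixed (parabolic \<alpha> :: ('k^2^2) set)) = cofixed_series q \<alpha>)"
proof -
  have q: "2 \<le> q" unfolding assms by (rule CARD_field_ge_2)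
  \<comment> \<open>The equivalence holds for each composition separately; the conjunction over both
    is formed only at the end.\<close>
  have "(\<forall>m. Hilb (fixed_quotient (GL2 :: ('k^2^2) set) (frobenius_power (q ^ m))) = C_series q [2] m)
      \<longleftrightarrow> Hilb (cofixed (GL2 :: ('k^2^2) set)) = cofixed_series q [2]"
  proof (rule Hilb_fixed_iff_Hilb_cofixed [OF _ assms])
    show "\<exists>N. fps_nth (geo2 (q\<^sup>2 - 1) (q\<^sup>2 - q)) d = of_nat N
        \<and> card (invariants (GL2 :: ('k^2^2) set) d) = q ^ N" for d
      by (rule card_eq_power_geo2)
        (use card_invariants_GL2 exponents_pos [OF q] in \<open>simp_all only: assms\<close>)
  qed (simp_all only: GL2_def mem_Collect_eq C_series_low [OF q] C_series_reversed [OF q] C_series_high [OF q])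
  moreover have "(\<forall>m. Hilb (fixed_quotient (borel2 :: ('k^2^2) set) (frobenius_power (q ^ m))) = C_series q [1, 1] m)
      \<longleftrightarrow> Hilb (cofixed (borel2 :: ('k^2^2) set)) = cofixed_series q [1, 1]"
  proof (rule Hilb_fixed_iff_Hilb_cofixed [OF _ assms])
    show "\<exists>N. fps_nth (geo2 (q - 1) (q\<^sup>2 - q)) d = of_nat N
        \<and> card (invariants (borel2 :: ('k^2^2) set) d) = q ^ N" for d
      by (rule card_eq_power_geo2)
        (use card_invariants_borel2 exponents_pos [OF q] in \<open>simp_all only: assms\<close>)
  qed (simp_all only: borel2_def mem_Collect_eq C_series_low [OF q] C_series_reversed [OF q] C_series_high [OF q])
  ultimately show ?thesis by (simp only: compositions_2 ball_simps parabolic_2 parabolic_1_1 HOL.simp_thms)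
qed

end
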